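(* Let $(Z_t)_{t\ge0}$ (with probability measures $\mathbb P^{(s,x)}$) be a branching process on $[0,\infty]$ whose Laplace exponents $(v_{s,t})_{(s,t)\in\Delta}$ form an absolutely continuous reverse evolution family in $\mathbb H$, and let $\phi(\zeta,t)=-q_t+a_t\zeta+b_t\zeta^2+\int_0^\infty(e^{-\zeta x}-1+\zeta x\mathbf 1_{(0,1)}(x))\pi_t(\mathrm dx)$ be its associated Herglotz vector field, with Lévy family $(q_t,a_t,b_t,\pi_t)_{t\ge0}$. The following are equivalent: (1) $\mathbb E^{(s,x)}[Z_t]<\infty$ for all $x\in(0,\infty)$ and $(s,t)\in\Delta$; (2) $\mathbb E^{(0,1)}[Z_t]<\infty$ for all $t\ge0$; (3) $v_{0,t}(0)=0$ and $v_{0,t}'(0)<\infty$ for all $t\ge0$; (4) $v_{s,t}(0)=0$ and $v_{s,t}'(0)<\infty$ for all $(s,t)\in\Delta$; (5) $\phi(0,t)=0$ for a.e. $t\ge0$ and $t\mapsto\phi'(0,t)$ is in $L^1_{\rm loc}$; (6) $q_t=0$ for a.e. $t\ge0$ and $t\mapsto\int_{[1,\infty)}x\,\pi_t(\mathrm dx)$ is in $L^1_{\rm loc}$. If these hold, then $\mathbb E^{(s,x)}[Z_t]=x\,v_{s,t}'(0)=x\exp\!\big(-\int_s^t\phi'(0,r)\,\mathrm dr\big)$ for all $x\in(0,\infty)$ and $(s,t)\in\Delta$.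
   Context: $\Delta=\{(s,t):0\le s\le t\}$, $\mathbb H=\{\operatorname{Re}\zeta>0\}$. A branching process on $[0,\infty]$ is a Markov family $(Z_t)$ (process with filtration $\mathcal F_I$ and probability measures $\mathbb P^{(s,x)}$ with $\mathbb P^{(s,x)}[Z_s=x]=1$ and the Markov property $\mathbb E^{(s,x)}[f(Z_u)|\mathcal F_{[s,t]}]=\int f(y)k_{t,u}(Z_t,\mathrm dy)$) whose transition kernels $(k_{s,t})$ on $[0,\infty]$ satisfy $k_{s,s}(x,\cdot)=\delta_x$, Chapman–Kolmogorov $k_{s,t}\star k_{t,u}=k_{s,u}$, weak continuity of $(s,t,x)\mapsto k_{s,t}(x,\cdot)$ on $\Delta\times[0,\infty)$, the branching property $k_{s,t}(x,\cdot)\ast k_{s,t}(y,\cdot)=k_{s,t}(x+y,\cdot)$, $k_{s,t}(0,\cdot)=\delta_0$, $k_{s,t}(\infty,\cdot)=\delta_\infty$. Its Laplace exponents are the Bernstein functions $v_{s,t}$ with $\int_{[0,\infty)}e^{-\theta y}k_{s,t}(x,\mathrm dy)=e^{-xv_{s,t}(\theta)}$, extended holomorphically to $\mathbb H$. Absolutely continuous reverse evolution family: $v_{s,s}={\rm id}$, $v_{s,u}=v_{s,t}\circ v_{t,u}$, and $|v_{s,u}(z)-v_{s,t}(z)|\le\int_t^u f_z$ for some nonnegative $f_z\in L^1_{\rm loc}$. Its associated Herglotz vector field is the (a.e.-unique) $\phi$ such that $s\mapsto v_{s,t}(\zeta)$ solves $\frac{\mathrm d}{\mathrm ds}v(s)=\phi(v(s),s)$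 a.e. on $[0,t]$, $v(t)=\zeta$; such $\phi$ has the stated form with a Lévy family ($a_t\in\mathbb R$, $q_t,b_t\ge0$, $\pi_t$ measures on $(0,\infty)$ with $\int\min\{1,x^2\}\pi_t<\infty$, integrability conditions in $t$). Notation: $v_{s,t}(0)=\lim_{\theta\to0^+}v_{s,t}(\theta)$, $v'_{s,t}(0)=\lim_{\theta\to0^+}v'_{s,t}(\theta)$, $\phi(0,t)=\lim_{\theta\to0^+}\phi(\theta,t)\in(-\infty,\infty]$, $\phi'(0,t)=\lim_{\theta\to0^+}\phi'(\theta,t)\in[-\infty,\infty)$, derivatives being in the spatial variable. *)

theory Defs
  imports "HOL-Probability.Probability"
begin

definition Delta :: "(real \<times> real) set" where
  "Delta = {(s,t). 0 \<le> s \<and> s \<le> t}"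

definition Hplane :: "complex set" where
  "Hplane = {z. 0 < Re z}"

definition conv_meas :: "ennreal measure \<Rightarrow> ennreal measure \<Rightarrow> ennreal measure" where
  "conv_meas M N = distr (M \<Otimes>\<^sub>M N) borel (\<lambda>(a,b). a + b)"

definition locL1 :: "(real \<Rightarrow> ereal) \<Rightarrow> bool" where
  "locL1 f \<longleftrightarrow> (AE t in lborel. 0 \<le> t \<longrightarrow> \<bar>f t\<bar> \<noteq> \<infinity>) \<and>
     (\<forall>T\<ge>0. set_integrable lborel {0..T} (\<lambda>t. real_of_ereal (f t)))"

definition lim0 :: "(real \<Rightarrow> real) \<Rightarrow> ereal" where
  "lim0 g = Lim (at_right 0) (\<lambda>\<theta>. ereal (g \<theta>))"

definition branching_kernels :: "(real \<Rightarrow> real \<Rightarrow> ennreal \<Rightarrow> ennreal measure) \<Rightarrow> bool" where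
  "branching_kernels k \<longleftrightarrow>
     (\<forall>s t x. (s,t) \<in> Delta \<longrightarrow> prob_space (k s t x) \<and> sets (k s t x) = sets borel) \<and>
     (\<forall>s t A. (s,t) \<in> Delta \<longrightarrow> A \<in> sets borel \<longrightarrow>
         (\<lambda>x. emeasure (k s t x) A) \<in> borel_measurable borel) \<and>
     (\<forall>s x. 0 \<le> s \<longrightarrow> k s s x = return borel x) \<and>
     (\<forall>s t u x A. 0 \<le> s \<longrightarrow> s \<le> t \<longrightarrow> t \<le> u \<longrightarrow> A \<in> sets borel \<longrightarrow>
         emeasure (k s u x) A = (\<integral>\<^sup>+ y. emeasure (k t u y) A \<partial>(k s t x))) \<and>
     (\<forall>f :: ennreal \<Rightarrow> real. continuous_on UNIV f \<longrightarrow> bounded (range f) \<longrightarrow>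
         continuous_on {(s,t,x). 0 \<le> s \<and> s \<le> t \<and> 0 \<le> x}
           (\<lambda>(s,t,x). \<integral> y. f y \<partial>(k s t (ennreal x)))) \<and>
     (\<forall>s t x y. (s,t) \<in> Delta \<longrightarrow> conv_meas (k s t x) (k s t y) = k s t (x + y)) \<and>
     (\<forall>s t. (s,t) \<in> Delta \<longrightarrow> k s t 0 = return borel 0 \<and> k s t \<top> = return borel \<top>)"

definition branching_process ::
  "'w measure \<Rightarrow> (real \<Rightarrow> real \<Rightarrow> 'w measure) \<Rightarrow> (real \<Rightarrow> ennreal \<Rightarrow> 'w measure)
    \<Rightarrow> (real \<Rightarrow> 'w \<Rightarrow> ennreal) \<Rightarrow> (real \<Rightarrow> real \<Rightarrow> ennreal \<Rightarrow> ennreal measure) \<Rightarrow> bool" where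
  "branching_process M F P Z k \<longleftrightarrow>
     branching_kernels k \<and>
     (\<forall>t\<ge>0. Z t \<in> borel_measurable M) \<and>
     (\<forall>s t. (s,t) \<in> Delta \<longrightarrow> subalgebra M (F s t)) \<and>
     (\<forall>s t s' t'. 0 \<le> s' \<longrightarrow> s' \<le> s \<longrightarrow> s \<le> t \<longrightarrow> t \<le> t' \<longrightarrow> sets (F s t) \<subseteq> sets (F s' t')) \<and>
     (\<forall>s t r. 0 \<le> s \<longrightarrow> s \<le> r \<longrightarrow> r \<le> t \<longrightarrow> Z r \<in> borel_measurable (F s t)) \<and>
     (\<forall>s x. 0 \<le> s \<longrightarrow> prob_space (P s x) \<and> sets (P s x) = sets M) \<and>
     (\<forall>s x. 0 \<le> s \<longrightarrow> emeasure (P s x) {\<omega> \<in> space M. Z s \<omega> = x} = 1) \<and>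
     (\<forall>s t u x (f :: ennreal \<Rightarrow> real). 0 \<le> s \<longrightarrow> s \<le> t \<longrightarrow> t \<le> u \<longrightarrow>
        f \<in> borel_measurable borel \<longrightarrow> bounded (range f) \<longrightarrow>
        (AE \<omega> in P s x. real_cond_exp (P s x) (F s t) (\<lambda>\<omega>. f (Z u \<omega>)) \<omega>
                         = (\<integral> y. f y \<partial>(k t u (Z t \<omega>)))))"

definition laplace_exponents ::
  "(real \<Rightarrow> real \<Rightarrow> ennreal \<Rightarrow> ennreal measure) \<Rightarrow> (real \<Rightarrow> real \<Rightarrow> complex \<Rightarrow> complex) \<Rightarrow> bool" where
  "laplace_exponents k v \<longleftrightarrow>
     (\<forall>s t \<theta> x. (s,t) \<in> Delta \<longrightarrow> 0 < \<theta> \<longrightarrow> 0 \<le> x \<longrightarrow>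
        v s t (complex_of_real \<theta>) \<in> \<real> \<and>
        (\<integral>\<^sup>+ y \<in> {..<\<top>}. ennreal (exp (- \<theta> * enn2real y)) \<partial>(k s t (ennreal x)))
          = ennreal (exp (- x * Re (v s t (complex_of_real \<theta>))))) \<and>
     (\<forall>s t. (s,t) \<in> Delta \<longrightarrow> v s t holomorphic_on Hplane)"

definition abs_cont_REF :: "(real \<Rightarrow> real \<Rightarrow> complex \<Rightarrow> complex) \<Rightarrow> bool" where
  "abs_cont_REF v \<longleftrightarrow>
     (\<forall>s t. (s,t) \<in> Delta \<longrightarrow> v s t holomorphic_on Hplane \<and> v s t ` Hplane \<subseteq> Hplane) \<and>
     (\<forall>s z. 0 \<le> s \<longrightarrow> z \<in> Hplane \<longrightarrow> v s s z = z) \<and>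
     (\<forall>s t u z. 0 \<le> s \<longrightarrow> s \<le> t \<longrightarrow> t \<le> u \<longrightarrow> z \<in> Hplane \<longrightarrow> v s u z = v s t (v t u z)) \<and>
     (\<forall>z \<in> Hplane. \<exists>f :: real \<Rightarrow> real. (\<forall>r. 0 \<le> f r) \<and>
        (\<forall>T\<ge>0. set_integrable lborel {0..T} f) \<and>
        (\<forall>s t u. 0 \<le> s \<longrightarrow> s \<le> t \<longrightarrow> t \<le> u \<longrightarrow>
            cmod (v s u z - v s t z) \<le> (LINT r:{t..u}|lborel. f r)))"

definition levy_family ::
  "(real \<Rightarrow> real) \<Rightarrow> (real \<Rightarrow> real) \<Rightarrow> (real \<Rightarrow> real) \<Rightarrow> (real \<Rightarrow> real measure) \<Rightarrow> bool" where
  "levy_family q a b \<pi> \<longleftrightarrow>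
     (\<forall>t\<ge>0. 0 \<le> q t \<and> 0 \<le> b t \<and> sets (\<pi> t) = sets borel \<and> emeasure (\<pi> t) {..0} = 0 \<and>
        (\<integral>\<^sup>+ x. ennreal (min 1 (x\<^sup>2)) \<partial>(\<pi> t)) < \<infinity>) \<and>
     (\<forall>A \<in> sets borel. (\<lambda>t. emeasure (\<pi> t) A) \<in> borel_measurable borel) \<and>
     locL1 (\<lambda>t. ereal (q t)) \<and> locL1 (\<lambda>t. ereal (a t)) \<and> locL1 (\<lambda>t. ereal (b t)) \<and>
     locL1 (\<lambda>t. enn2ereal (\<integral>\<^sup>+ x. ennreal (min 1 (x\<^sup>2)) \<partial>(\<pi> t)))"

definition herglotz_levy ::
  "(complex \<Rightarrow> real \<Rightarrow> complex) \<Rightarrow> (real \<Rightarrow> real) \<Rightarrow> (real \<Rightarrow> real) \<Rightarrow> (real \<Rightarrow> real)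
     \<Rightarrow> (real \<Rightarrow> real measure) \<Rightarrow> bool" where
  "herglotz_levy \<phi> q a b \<pi> \<longleftrightarrow>
     (\<forall>t\<ge>0. \<forall>\<zeta>\<in>Hplane. \<phi> \<zeta> t =
        - complex_of_real (q t) + complex_of_real (a t) * \<zeta> + complex_of_real (b t) * \<zeta>\<^sup>2 +
        (\<integral> x. (exp (- \<zeta> * complex_of_real x) - 1 + \<zeta> * complex_of_real x * indicator {0<..<1} x) \<partial>(\<pi> t)))"

text \<open>phi is the Herglotz vector field associated with v: s \<mapsto> v s t \<zeta> solves
  d/ds v(s) = phi(v(s), s) a.e. on [0,t] (with v(t) = \<zeta>, which holds as v t t = id).\<close>

definition assoc_herglotz ::
  "(real \<Rightarrow> real \<Rightarrow> complex \<Rightarrow> complex) \<Rightarrow> (complex \<Rightarrow> real \<Rightarrow> complex) \<Rightarrow> bool" where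
  "assoc_herglotz v \<phi> \<longleftrightarrow>
     (\<forall>t \<zeta>. 0 \<le> t \<longrightarrow> \<zeta> \<in> Hplane \<longrightarrow>
        (AE s in lborel. s \<in> {0..t} \<longrightarrow>
           ((\<lambda>s. v s t \<zeta>) has_vector_derivative \<phi> (v s t \<zeta>) s) (at s)))"

end

theory Submission
  imports Defs
begin

text \<open>
  Write \<open>V\<close> for the Laplace exponents on the positive axis. They are positive, increasing and concave,
  and by monotone convergence the mean of \<open>Z\<^sub>t\<close> is the limit of \<open>(1 - exp (- x V\<^sub>s\<^sub>t(\<theta>))) / \<theta>\<close> as
  \<open>\<theta>\<close> decreases to \<open>0\<close>; this settles the equivalence of (1)--(4), using
  \<open>V\<^sub>0\<^sub>t = V\<^sub>0\<^sub>s \<circ> V\<^sub>s\<^sub>t\<close> to pass from \<open>s = 0\<close> to general \<open>s\<close>.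

  For the vector field, put \<open>H(\<theta>, r) = \<phi>(\<theta>, r) / \<theta>\<close>. Since \<open>s \<mapsto> ln V\<^sub>s\<^sub>t(\<theta>)\<close> is absolutely continuous with
  derivative \<open>H(V\<^sub>s\<^sub>t(\<theta>), s)\<close>, one has \<open>ln \<theta> - ln V\<^sub>s\<^sub>t(\<theta>) = \<integral> H(V\<^sub>r\<^sub>t(\<theta>), r) dr\<close> over \<open>[s,t]\<close>.
  As \<open>\<theta>\<close> decreases to \<open>0\<close>, \<open>H(\<theta>, r)\<close> decreases to \<open>\<phi>'(0, r) = a\<^sub>r - \<integral> x \<pi>\<^sub>r(dx)\<close> (integral over \<open>[1,\<infinity>)\<close>) if
  \<open>q\<^sub>r = 0\<close> and to \<open>-\<infinity>\<close> otherwise, so monotone convergence in this identity yields (4) \<open>\<Longrightarrow>\<close> (6) together with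
  the formula for the mean, and \<open>H \<ge> \<phi>'(0, \<cdot>)\<close> yields (6) \<open>\<Longrightarrow>\<close> (4).
\<close>

text \<open>Two difficulties shape the argument. Measurability of r \<mapsto> H(V(r,t,\<theta>), r)
  along a trajectory is not derived from the Levy family but from the evolution equation itself: a
  gauge-integral form of the fundamental theorem needs only absolute continuity and the derivative
  almost everywhere, and gauge integrability implies Lebesgue measurability. This is why the
  integrals of H live on \<open>lebesgue_on\<close> and pass to \<open>lborel\<close> only for the
  Borel function a - m, where m is the first moment of the jumps of size at least 1. Secondly, H is
  evaluated at the moving point V(r,t,\<theta>), which tends to 0 with \<theta> only if V(r,t,0) = 0
  for every r in [s,t]; hence (3) is strengthened to (4) before the vector field is used.

  Dividing \<phi> by \<theta> makes the integrand monotone, and its limit -\<infinity> where q > 0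
  lets a single monotone limit show both that q vanishes and that m is finite. Condition (5) speaks
  of \<phi>' instead, which has the same limit when q = 0; since differentiation removes q, (5) has
  to require \<phi>(0,t) = 0 separately.\<close>

section \<open>Absolutely continuous functions\<close>

text \<open>
  In the gauge argument, the tags in the exceptional null set are confined to an open set of small
  measure with respect to the density \<open>F\<close>, which bounds the increments of \<open>g\<close> there.
\<close>

lemma ftc_AE_derivative:
  fixes g h F :: "real \<Rightarrow> real"
  assumes ab: "a \<le> b"
    and F: "set_integrable lborel {a..b} F" and F0: "\<And>x. 0 \<le> F x"
    and AC: "\<And>x y. a \<le> x \<Longrightarrow> x \<le> y \<Longrightarrow> y \<le> b \<Longrightarrow> \<bar>g y - g x\<bar> \<le> (LINT r:{x..y}|lborel. F r)"
    and der: "AE x in lborel. x \<in> {a..b} \<longrightarrow> (g has_real_derivative h x) (at x)"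
  shows "(h has_integral g b - g a) {a..b}"
proof -
  \<comment> \<open>The measure with density \<open>F\<close> turns the bound on increments into a
    set function, so that increments over disjoint cells add up to the mass of a union.\<close>
  define M where "M = density lborel (\<lambda>r. ennreal (indicator {a..b} r * F r))"
  have iF: "integrable lborel (\<lambda>r. indicator {a..b} r * F r)"
    using F by (simp add: set_integrable_def)
  then have [measurable]: "(\<lambda>r. indicator {a..b} r * F r) \<in> borel_measurable borel"
    using borel_measurable_integrable by force
  have sM: "sets M = sets borel" by (simp add: M_def)
  have M_eq: "emeasure M A = ennreal (LINT r:A|lborel. F r)" if A: "A \<in> sets borel" "A \<subseteq> {a..b}" for A
  proof -
    have [measurable]: "A \<in> sets borel" using A by simp
    have e: "indicator {a..b} r * F r * indicator A r = indicator A r * F r" for r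
      using A by (auto split: split_indicator)
    have "emeasure M A = (\<integral>\<^sup>+r. ennreal (indicator {a..b} r * F r) * indicator A r \<partial>lborel)"
      unfolding M_def by (subst emeasure_density) auto
    also have "\<dots> = (\<integral>\<^sup>+r. ennreal (indicator A r * F r) \<partial>lborel)"
      by (rule nn_integral_cong) (use A in \<open>auto split: split_indicator\<close>)
    also have "\<dots> = ennreal (\<integral>r. indicator A r * F r \<partial>lborel)"
    proof (rule nn_integral_eq_integral)
      have "integrable lborel (\<lambda>r. indicator A r *\<^sub>R (indicator {a..b} r * F r))"
        by (rule integrable_mult_indicator[OF _ iF]) simp
      moreover have "(\<lambda>r. indicator A r *\<^sub>R (indicator {a..b} r * F r)) = (\<lambda>r. indicator A r * F r)"
        using e by (simp add: ac_simps fun_eq_iff)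
      ultimately show "integrable lborel (\<lambda>r. indicator A r * F r)"
        by metis
    qed (use F0 in auto)
    finally show ?thesis by (simp add: set_lebesgue_integral_def)
  qed
  have fin: "finite_measure M"
  proof (rule finite_measureI)
    have "emeasure M (space M) = (\<integral>\<^sup>+r. ennreal (indicator {a..b} r * F r) \<partial>lborel)"
      unfolding M_def by (subst emeasure_density) (auto intro!: nn_integral_cong)
    also have "\<dots> = ennreal (\<integral>r. indicator {a..b} r * F r \<partial>lborel)"
      using iF F0 by (intro nn_integral_eq_integral) auto
    finally show "emeasure M (space M) \<noteq> \<infinity>" by simp
  qed
  interpret finite_measure M by (rule fin)
  \<comment> \<open>Endpoints carry no mass. Open intervals are used because cells of a tagged
    division may share endpoints, while their interiors are disjoint.\<close>
  have M_Ioo: "\<bar>g v - g u\<bar> \<le> measure M {u<..<v}" if "a \<le> u" "u \<le> v" "v \<le> b" for u v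
  proof -
    have "(LINT r:{u..v}|lborel. F r) = (LINT r:{u<..<v}|lborel. F r)"
    proof -
      have *: "(LINT r:A|lborel. F r) = (LINT r:A|lborel. indicator {a..b} r * F r)" if "A \<subseteq> {a..b}" for A
        unfolding set_lebesgue_integral_def using that by (intro Bochner_Integration.integral_cong) (auto split: split_indicator)
      have "(LINT r:{u..v}|lborel. indicator {a..b} r * F r) = (LINT r:{u<..<v}|lborel. indicator {a..b} r * F r)"
        unfolding set_lebesgue_integral_def
      proof (rule integral_cong_AE)
        show "AE r in lborel. indicator {u..v} r *\<^sub>R (indicator {a..b} r * F r) = indicator {u<..<v} r *\<^sub>R (indicator {a..b} r * F r)"
          using AE_lborel_singleton[of u] AE_lborel_singleton[of v]
          by eventually_elim (auto split: split_indicator)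
      qed measurable
      moreover have "{u<..<v} \<subseteq> {a..b}" using that by auto
      ultimately show ?thesis using *[of "{u..v}"] *[of "{u<..<v}"] that by auto
    qed
    moreover have "measure M {u<..<v} = (LINT r:{u<..<v}|lborel. F r)"
    proof -
      have "{u<..<v} \<subseteq> {a..b}" using that by auto
      moreover have "0 \<le> (LINT r:{u<..<v}|lborel. F r)"
        using F0 unfolding set_lebesgue_integral_def by (intro Bochner_Integration.integral_nonneg) auto
      ultimately show ?thesis using M_eq[of "{u<..<v}"] by (simp add: measure_def)
    qed
    ultimately show ?thesis using AC[of u v] that by simp
  qed
  obtain N where N: "N \<in> null_sets lborel" "{x. \<not> (x \<in> {a..b} \<longrightarrow> (g has_real_derivative h x) (at x))} \<subseteq> N"
    using AE_E[OF der] by (auto simp: null_sets_def)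
  have Nb: "N \<in> sets borel" using N by auto
  have MN: "emeasure M N = 0"
    using absolutely_continuousI_density[of "(\<lambda>r. ennreal (indicator {a..b} r * F r))" lborel] N
    by (auto simp: absolutely_continuous_def M_def)
  \<comment> \<open>\<open>h\<close> is uncontrolled on \<open>N\<close>; with the value 0 there, a
    cell tagged in \<open>N\<close> contributes only its increment of \<open>g\<close>. The spike at
    the end restores \<open>h\<close>.\<close>
  define h0 where "h0 x = (if x \<in> N then 0 else h x)" for x
  have "(h0 has_integral g b - g a) {a..b}"
    unfolding has_integral_real
  proof safe
    fix e :: real assume e: "0 < e"
    \<comment> \<open>Half of \<open>e\<close> is spent on cells tagged outside \<open>N\<close>,
      the other half on \<open>U\<close>; the summand 1 covers a = b.\<close>
    define e' where "e' = e / (2 * (b - a + 1))"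
    have e': "0 < e'" "e' * (b - a) < e / 2" using e ab by (auto simp: e'_def field_simps)
    have "\<exists>U. N \<subseteq> U \<and> open U \<and> measure M U < e / 2"
    proof -
      have "(INF U \<in> {U. N \<subseteq> U \<and> open U}. emeasure M U) < ennreal (e/2)"
        using outer_regular[OF sM _ Nb] MN emeasure_finite e by simp
      then obtain U where "N \<subseteq> U" "open U" "emeasure M U < ennreal (e/2)"
        by (auto simp: INF_less_iff)
      then show ?thesis using e by (auto simp: emeasure_eq_measure ennreal_less_iff)
    qed
    then obtain U where U: "N \<subseteq> U" "open U" "measure M U < e / 2" by blast
    have "\<exists>d>0. (x \<in> N \<longrightarrow> ball x d \<subseteq> U) \<and>
      (x \<in> {a..b} - N \<longrightarrow> (\<forall>y. \<bar>y - x\<bar> < d \<longrightarrow> \<bar>g y - g x - (y - x) * h x\<bar> \<le> e' * \<bar>y - x\<bar>))" for x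
    proof (cases "x \<in> N")
      case True
      then show ?thesis using U(1,2) open_contains_ball by auto
    next
      case False
      show ?thesis
      proof (cases "x \<in> {a..b}")
        case True
        with False N(2) have "(g has_real_derivative h x) (at x)" by auto
        then have "(g has_derivative (\<lambda>y. y * h x)) (at x)"
          by (simp add: has_field_derivative_def mult.commute[of _ "h x"])
        then show ?thesis using e'(1) False
          unfolding has_derivative_at_alt by (fastforce)
      qed (use False in \<open>auto intro: exI[of _ 1]\<close>)
    qed
    then obtain d where d0: "\<And>x. 0 < d x" and dN: "\<And>x. x \<in> N \<Longrightarrow> ball x (d x) \<subseteq> U"
      and dd: "\<And>x y. x \<in> {a..b} - N \<Longrightarrow> \<bar>y - x\<bar> < d x \<Longrightarrow> \<bar>g y - g x - (y - x) * h x\<bar> \<le> e' * \<bar>y - x\<bar>"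
      by metis
    show "\<exists>\<gamma>. gauge \<gamma> \<and> (\<forall>\<D>. \<D> tagged_division_of {a..b} \<and> \<gamma> fine \<D> \<longrightarrow>
        norm (sum (\<lambda>(x,k). Henstock_Kurzweil_Integration.content(k) *\<^sub>R h0 x) \<D> - (g b - g a)) < e)"
    proof (intro exI[of _ "\<lambda>x. ball x (d x)"] conjI allI impI; (elim conjE)?)
      show "gauge (\<lambda>x. ball x (d x))" using d0 gauge_ball_dependent by blast
      fix p assume p: "p tagged_division_of {a..b}" and fp: "(\<lambda>x. ball x (d x)) fine p"
      note pD = tagged_division_ofD[OF p]
      have ba: "b - a = (\<Sum>(x,K)\<in>p. Sup K - Inf K)" "g b - g a = (\<Sum>(x,K)\<in>p. g(Sup K) - g(Inf K))"
        using additive_tagged_division_1[OF ab p, of "\<lambda>x. x"] additive_tagged_division_1[OF ab p, of g] by auto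
      define p' where "p' = {z \<in> p. fst z \<in> N}"
      have finp: "finite p'" using pD(1) by (simp add: p'_def)
      have bound: "\<bar>Henstock_Kurzweil_Integration.content K * h0 x - (g (Sup K) - g (Inf K))\<bar>
          \<le> e' * (Sup K - Inf K) + (if x \<in> N then measure M (interior K) else 0)" if xK: "(x,K) \<in> p" for x K
      proof -
        obtain u v where K: "K = {u..v}" using pD(4)[OF xK] by auto
        have x: "u \<le> x" "x \<le> v" using pD(2)[OF xK] K by auto
        have uv: "a \<le> u" "u \<le> v" "v \<le> b" using pD(3)[OF xK] K x by auto
        have b1: "u \<in> ball x (d x)" "v \<in> ball x (d x)" using fineD[OF fp xK] K uv by auto
        show ?thesis
        proof (cases "x \<in> N")
          case True
          have "0 \<le> e' * (v - u)" using e' uv by auto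
          then show ?thesis using M_Ioo[OF uv] True K uv by (simp add: h0_def)
        next
          case False
          \<comment> \<open>Straddle estimate: the linear approximation at the tag is applied to
            both endpoints of the cell.\<close>
          have "\<bar>g u - g x - (u - x) * h x\<bar> \<le> e' * (x - u)" "\<bar>g v - g x - (v - x) * h x\<bar> \<le> e' * (v - x)"
            using dd[of x u] dd[of x v] b1 x uv False by (auto simp: dist_real_def)
          moreover have "(v - u) * h x - (g v - g u) = (g u - g x - (u - x) * h x) - (g v - g x - (v - x) * h x)"
            by (simp add: algebra_simps)
          ultimately have "\<bar>(v - u) * h x - (g v - g u)\<bar> \<le> e' * (x - u) + e' * (v - x)" by linarith
          then show ?thesis using False K uv by (simp add: h0_def algebra_simps)
        qed
      qed
      have "\<bar>(\<Sum>(x,K)\<in>p. Henstock_Kurzweil_Integration.content K * h0 x) - (g b - g a)\<bar>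
          = \<bar>\<Sum>(x,K)\<in>p. Henstock_Kurzweil_Integration.content K * h0 x - (g (Sup K) - g (Inf K))\<bar>"
        unfolding ba(2) by (simp add: sum_subtractf case_prod_beta)
      also have "\<dots> \<le> (\<Sum>(x,K)\<in>p. e' * (Sup K - Inf K) + (if x \<in> N then measure M (interior K) else 0))"
        using bound by (intro order_trans[OF sum_abs] sum_mono) (auto split del: if_split)
      also have "\<dots> = e' * (b - a) + (\<Sum>z\<in>p. if fst z \<in> N then measure M (interior (snd z)) else 0)"
        unfolding ba(1) by (simp add: sum.distrib case_prod_beta sum_distrib_left)
      also have "(\<Sum>z\<in>p. if fst z \<in> N then measure M (interior (snd z)) else 0)
          = (\<Sum>z\<in>p'. measure M (interior (snd z)))"
        unfolding p'_def using pD(1) by (simp add: sum.inter_filter)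
      also have "\<dots> = measure M (\<Union>z\<in>p'. interior (snd z))"
      proof (rule finite_measure_finite_Union[symmetric, OF finp])
        show "disjoint_family_on (\<lambda>z. interior (snd z)) p'"
          unfolding disjoint_family_on_def
        proof (intro ballI impI)
          fix y z assume "y \<in> p'" "z \<in> p'" "y \<noteq> z"
          then show "interior (snd y) \<inter> interior (snd z) = {}"
            using pD(5)[of "fst y" "snd y" "fst z" "snd z"] by (auto simp: p'_def)
        qed
        show "(\<lambda>z. interior (snd z)) ` p' \<subseteq> sets M" unfolding sM by auto
      qed
      also have "\<dots> \<le> measure M U"
      proof (rule finite_measure_mono)
        show "(\<Union>z\<in>p'. interior (snd z)) \<subseteq> U"
          using dN fineD[OF fp] interior_subset unfolding p'_def by fastforce
      qed (use U sM in auto)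
      finally show "norm (sum (\<lambda>(x,k). Henstock_Kurzweil_Integration.content(k) *\<^sub>R h0 x) p - (g b - g a)) < e"
        using U(3) e' by simp
    qed
  qed
  moreover have "negligible N" using N(1) negligible_iff_null_sets null_sets_completionI by blast
  ultimately show ?thesis
    by (rule has_integral_spike[rotated 2]) (auto simp: h0_def)
qed

section \<open>Levy measures and the vector field near the origin\<close>

text \<open>Slopes of chords from the origin decrease for the concave function \<theta> \<mapsto> 1
  - exp (- \<theta> x). This is behind both the monotone limit for the mean and the monotonicity of
  \<phi>(\<theta>) / \<theta>.\<close>

lemma one_minus_exp_div_antimono:
  fixes \<theta> \<theta>' x :: real
  assumes "0 < \<theta>" "\<theta> \<le> \<theta>'"
  shows "(1 - exp (- \<theta>' * x)) / \<theta>' \<le> (1 - exp (- \<theta> * x)) / \<theta>"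
proof -
  have "exp ((1 - \<theta>/\<theta>') *\<^sub>R 0 + (\<theta>/\<theta>') *\<^sub>R (- \<theta>' * x)) \<le> (1 - \<theta>/\<theta>') * exp 0 + (\<theta>/\<theta>') * exp (- \<theta>' * x)"
    using assms by (intro convex_onD[OF exp_convex]) auto
  then have "exp (- \<theta> * x) \<le> 1 - \<theta>/\<theta>' * (1 - exp (- \<theta>' * x))"
    using assms by (simp add: algebra_simps)
  then have "\<theta>/\<theta>' * (1 - exp (- \<theta>' * x)) \<le> 1 - exp (- \<theta> * x)" by simp
  then have "\<theta> * ((1 - exp (- \<theta>' * x)) / \<theta>') \<le> 1 - exp (- \<theta> * x)" by simp
  then show ?thesis using assms by (simp add: pos_le_divide_eq mult.commute)
qed

text \<open>The error \<theta> x^2 is integrable over small jumps and vanishes with \<theta>. Its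
  constant 1 instead of the sharp 1/2 comes from exp (- u) \<le> 1 / (1 + u).\<close>

lemma one_minus_exp_div_bounds:
  fixes \<theta> x :: real
  assumes p: "0 < \<theta>" "0 \<le> x"
  shows "x - \<theta> * x\<^sup>2 \<le> (1 - exp (- \<theta> * x)) / \<theta>" and "(1 - exp (- \<theta> * x)) / \<theta> \<le> x"
proof -
  define u where "u = \<theta> * x"
  have u: "0 \<le> u" using p by (simp add: u_def)
  have "exp (- u) \<le> 1 / (1 + u)"
    using u exp_ge_add_one_self[of u] by (simp add: exp_minus field_simps)
  also have "\<dots> \<le> 1 - u + u\<^sup>2"
  proof -
    have "(1 - u + u\<^sup>2) * (1 + u) = 1 + u ^ 3" by (simp add: algebra_simps power2_eq_square power3_eq_cube)
    then have "1 \<le> (1 - u + u\<^sup>2) * (1 + u)" using u by simp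
    then show ?thesis using u by (simp add: pos_divide_le_eq)
  qed
  finally have "u - u\<^sup>2 \<le> 1 - exp (- u)" by simp
  then have "\<theta> * (x - \<theta> * x\<^sup>2) \<le> 1 - exp (- \<theta> * x)" by (simp add: u_def algebra_simps power2_eq_square)
  then show "x - \<theta> * x\<^sup>2 \<le> (1 - exp (- \<theta> * x)) / \<theta>" using p by (simp add: pos_le_divide_eq mult.commute)
  have "1 - exp (- \<theta> * x) \<le> \<theta> * x" using exp_ge_add_one_self[of "- \<theta> * x"] by linarith
  then show "(1 - exp (- \<theta> * x)) / \<theta> \<le> x" using p by (simp add: pos_divide_le_eq mult.commute)
qed

lemma one_minus_exp_div_tendsto:
  fixes f :: "'a \<Rightarrow> real"
  assumes "0 \<le> x" "(f \<longlongrightarrow> 0) F" "eventually (\<lambda>n. 0 < f n) F"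
  shows "((\<lambda>n. (1 - exp (- f n * x)) / f n) \<longlongrightarrow> x) F"
proof (rule tendsto_sandwich)
  show "((\<lambda>n. x - f n * x\<^sup>2) \<longlongrightarrow> x) F" using assms(2) by (auto intro!: tendsto_eq_intros)
  show "\<forall>\<^sub>F n in F. x - f n * x\<^sup>2 \<le> (1 - exp (- f n * x)) / f n" "\<forall>\<^sub>F n in F. (1 - exp (- f n * x)) / f n \<le> x"
    using assms(3) by (eventually_elim; use one_minus_exp_div_bounds assms(1) in blast)+
qed simp

text \<open>Serves to differentiate under an integral sign: a pointwise quadratic bound of the
  remainder is simply integrated.\<close>

lemma has_field_derivative_quadratic_remainder:
  fixes f :: "'a::real_normed_field \<Rightarrow> 'a"
  assumes d: "0 < d" and b: "\<And>h. norm h < d \<Longrightarrow> norm (f (z + h) - f z - h * D) \<le> C * (norm h)\<^sup>2"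
  shows "(f has_field_derivative D) (at z)"
  unfolding DERIV_def
proof (rule LIM_zero_cancel, rule Lim_null_comparison)
  show "((\<lambda>h. \<bar>C\<bar> * norm h) \<longlongrightarrow> 0) (at (0::'a))"
    by (auto intro!: tendsto_eq_intros)
  show "\<forall>\<^sub>F h in at 0. norm ((f (z + h) - f z) / h - D) \<le> \<bar>C\<bar> * norm h"
    unfolding eventually_at
  proof (intro exI[of _ d] conjI ballI impI d)
    fix h :: 'a assume h: "h \<noteq> 0 \<and> dist h 0 < d"
    then have "norm ((f (z + h) - f z) / h - D) = norm (f (z + h) - f z - h * D) / norm h"
      by (simp add: field_simps flip: norm_divide)
    also have "\<dots> \<le> C * (norm h)\<^sup>2 / norm h"
      using h b[of h] by (intro divide_right_mono) auto
    also have "\<dots> \<le> \<bar>C\<bar> * norm h"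
      using h by (simp add: power2_eq_square mult_right_mono)
    finally show "norm ((f (z + h) - f z) / h - D) \<le> \<bar>C\<bar> * norm h" .
  qed
qed

definition jump_integrand :: "complex \<Rightarrow> real \<Rightarrow> complex" where
  "jump_integrand \<zeta> x = exp (- \<zeta> * complex_of_real x) - 1 + \<zeta> * complex_of_real x * indicator {0<..<1} x"

section \<open>Levy measures and their truncated first moments\<close>

locale levy_measure =
  fixes \<pi> :: "real measure"
  assumes sets_levy [simp, measurable_cong]: "sets \<pi> = sets borel"
    and null_nonpos: "emeasure \<pi> {..0} = 0"
    and finite_min: "(\<integral>\<^sup>+ x. ennreal (min 1 (x\<^sup>2)) \<partial>\<pi>) < \<infinity>"
begin

definition mass :: real where "mass = (\<integral>x. min 1 (x\<^sup>2) \<partial>\<pi>)"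

definition big_jumps :: ennreal where "big_jumps = (\<integral>\<^sup>+ x \<in> {1..}. ennreal x \<partial>\<pi>)"

text \<open>A measure on the open half-line is encoded as a Borel measure on the line vanishing on
  \<open>{..0}\<close>, so bounds for x > 0 become bounds almost everywhere.\<close>

lemma AE_pos: "AE x in \<pi>. 0 < x"
proof (rule AE_I)
  show "{x \<in> space \<pi>. \<not> 0 < x} \<subseteq> {..0}" by auto
qed (auto simp: null_nonpos)

lemma integrable_min: "integrable \<pi> (\<lambda>x. min 1 (x\<^sup>2))"
  using finite_min by (intro integrableI_nonneg) auto

lemma integrable_bounded:
  fixes f :: "real \<Rightarrow> 'b::{banach, second_countable_topology}"
  assumes "f \<in> borel_measurable borel" "\<And>x. 0 < x \<Longrightarrow> norm (f x) \<le> C * min 1 (x\<^sup>2)" "0 \<le> C"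
  shows "integrable \<pi> f" "norm (integral\<^sup>L \<pi> f) \<le> C * mass"
proof -
  have f[measurable]: "f \<in> borel_measurable \<pi>" using assms(1) by simp
  have i: "integrable \<pi> (\<lambda>x. C * min 1 (x\<^sup>2))" using integrable_min by simp
  have b: "AE x in \<pi>. norm (f x) \<le> C * min 1 (x\<^sup>2)"
    using AE_pos by eventually_elim (use assms in auto)
  show 1: "integrable \<pi> f"
    by (rule Bochner_Integration.integrable_bound[OF i]) (use b assms(3) in \<open>auto elim: eventually_mono\<close>)
  have "norm (integral\<^sup>L \<pi> f) \<le> (\<integral>x. norm (f x) \<partial>\<pi>)" by (rule integral_norm_bound)
  also have "\<dots> \<le> (\<integral>x. C * min 1 (x\<^sup>2) \<partial>\<pi>)"
    by (rule integral_mono_AE) (use 1 i b in auto)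
  finally show "norm (integral\<^sup>L \<pi> f) \<le> C * mass" by (simp add: mass_def)
qed

end

text \<open>
  Both \<open>\<phi>'(\<theta>)\<close> and \<open>\<phi>(\<theta>) / \<theta>\<close> are, up to an explicit polynomial part, integrals of \<open>x 1\<^sub>(\<^sub>0\<^sub>,\<^sub>1\<^sub>)(x) - \<kappa>\<^sub>\<theta>(x)\<close>
  with \<open>\<kappa>\<^sub>\<theta>(x)\<close> equal to \<open>x exp (- \<theta> x)\<close> or \<open>(1 - exp (- \<theta> x)) / \<theta>\<close>; the bounds below cover both.
\<close>

locale levy_truncation = levy_measure +
  fixes \<kappa> :: "real \<Rightarrow> real \<Rightarrow> real"
  assumes meas [measurable]: "\<And>\<theta>. \<kappa> \<theta> \<in> borel_measurable borel"
    and lower: "\<And>\<theta> x. 0 < \<theta> \<Longrightarrow> 0 < x \<Longrightarrow> x - \<theta> * x\<^sup>2 \<le> \<kappa> \<theta> x"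
    and upper: "\<And>\<theta> x. 0 < \<theta> \<Longrightarrow> 0 < x \<Longrightarrow> \<kappa> \<theta> x \<le> x"
    and upper_inverse: "\<And>\<theta> x. 0 < \<theta> \<Longrightarrow> 0 < x \<Longrightarrow> \<kappa> \<theta> x \<le> 1 / \<theta>"
    and nonneg: "\<And>\<theta> x. 0 < \<theta> \<Longrightarrow> 0 < x \<Longrightarrow> 0 \<le> \<kappa> \<theta> x"
    and antimono: "\<And>\<theta> \<theta>' x. 0 < \<theta> \<Longrightarrow> \<theta> \<le> \<theta>' \<Longrightarrow> 0 < x \<Longrightarrow> \<kappa> \<theta>' x \<le> \<kappa> \<theta> x"
begin

definition G :: "real \<Rightarrow> real" where
  "G \<theta> = (\<integral>x. indicator {0<..<1} x * x - \<kappa> \<theta> x \<partial>\<pi>)"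

text \<open>For x < 1 \<open>lower\<close> gives \<theta> x^2; for x \<ge> 1 the compensator is
  absent and \<open>upper_inverse\<close> gives 1 / \<theta>. The sum of the constants serves both
  cases.\<close>

lemma integrand_bound:
  assumes "0 < \<theta>" "0 < x"
  shows "\<bar>indicator {0<..<1} x * x - \<kappa> \<theta> x\<bar> \<le> (\<theta> + 1 / \<theta>) * min 1 (x\<^sup>2)"
proof (cases "x < 1")
  case True
  then have "x\<^sup>2 \<le> 1" using assms by (simp add: power_le_one)
  moreover have "0 \<le> x\<^sup>2 / \<theta>" using assms by simp
  moreover have "(\<theta> + 1 / \<theta>) * x\<^sup>2 = \<theta> * x\<^sup>2 + x\<^sup>2 / \<theta>" by (simp add: distrib_right)
  ultimately have "x - \<kappa> \<theta> x \<le> (\<theta> + 1 / \<theta>) * x\<^sup>2" using lower[OF assms] by linarith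
  then show ?thesis using True assms \<open>x\<^sup>2 \<le> 1\<close> upper[OF assms] by (simp add: min_def)
next
  case False
  then have "1 \<le> x\<^sup>2" by simp
  then show ?thesis using False assms upper_inverse[OF assms] nonneg[OF assms] by (auto simp: min_def)
qed

lemma integrable_integrand: "0 < \<theta> \<Longrightarrow> integrable \<pi> (\<lambda>x. indicator {0<..<1} x * x - \<kappa> \<theta> x)"
  by (rule integrable_bounded(1)[where C = "\<theta> + 1 / \<theta>"]) (use integrand_bound in auto)

lemma G_bound: "0 < \<theta> \<Longrightarrow> \<bar>G \<theta>\<bar> \<le> (\<theta> + 1 / \<theta>) * mass"
  unfolding G_def real_norm_def[symmetric]
  by (rule integrable_bounded(2)) (use integrand_bound in auto)

lemma G_mono: "0 < \<theta> \<Longrightarrow> \<theta> \<le> \<theta>' \<Longrightarrow> G \<theta> \<le> G \<theta>'"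
  unfolding G_def
  by (rule integral_mono_AE) (use integrable_integrand AE_pos antimono in \<open>auto elim!: eventually_mono\<close>)

text \<open>Split at 1: the small jumps contribute at most \<theta> times \<open>mass\<close>, and
  the large ones increase to \<open>big_jumps\<close> by monotone convergence. The limit may be
  -\<infinity>; the extended sum is unambiguous because the small part has a finite limit.\<close>

lemma G_tendsto: "((\<lambda>\<theta>. ereal (G \<theta>)) \<longlongrightarrow> - enn2ereal big_jumps) (at_right 0)"
proof -
  define G1 where "G1 \<theta> = (\<integral>x. indicator {0<..<1} x * (x - \<kappa> \<theta> x) \<partial>\<pi>)" for \<theta>
  define G2 where "G2 \<theta> = (\<integral>x. indicator {1..} x * \<kappa> \<theta> x \<partial>\<pi>)" for \<theta>
  have b1: "norm (indicator {0<..<1} x * (x - \<kappa> \<theta> x)) \<le> \<theta> * min 1 (x\<^sup>2)" if "0 < \<theta>" "0 < x" for \<theta> x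
  proof (cases "x < 1")
    case True
    then have "x\<^sup>2 \<le> 1" using that by (simp add: power_le_one)
    then show ?thesis using that lower[OF that] upper[OF that] by (auto simp: min_def split: split_indicator)
  qed (use that in auto)
  have b2: "norm (indicator {1..} x * \<kappa> \<theta> x) \<le> 1/\<theta> * min 1 (x\<^sup>2)" if "0 < \<theta>" "0 < x" for \<theta> x
  proof (cases "x < 1")
    case False
    then have "1 \<le> x\<^sup>2" by simp
    then show ?thesis using that upper_inverse[OF that] nonneg[OF that] by (auto simp: min_def split: split_indicator)
  qed (use that in auto)
  have i1: "integrable \<pi> (\<lambda>x. indicator {0<..<1} x * (x - \<kappa> \<theta> x))" "\<bar>G1 \<theta>\<bar> \<le> \<theta> * mass" if "0 < \<theta>" for \<theta>
    using integrable_bounded[of "\<lambda>x. indicator {0<..<1} x * (x - \<kappa> \<theta> x)" \<theta>] b1[OF that] that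
    by (auto simp: G1_def)
  have i2: "integrable \<pi> (\<lambda>x. indicator {1..} x * \<kappa> \<theta> x)" if "0 < \<theta>" for \<theta>
    using integrable_bounded[of "\<lambda>x. indicator {1..} x * \<kappa> \<theta> x" "1/\<theta>"] b2[OF that] that
    by auto
  have G: "G \<theta> = G1 \<theta> - G2 \<theta>" if "0 < \<theta>" for \<theta>
  proof -
    have "G \<theta> = (\<integral>x. indicator {0<..<1} x * (x - \<kappa> \<theta> x) - indicator {1..} x * \<kappa> \<theta> x \<partial>\<pi>)"
      unfolding G_def by (rule integral_cong_AE) (use AE_pos in \<open>auto elim!: eventually_mono split: split_indicator\<close>)
    then show ?thesis using i1(1)[OF that] i2[OF that] by (simp add: G1_def G2_def)
  qed
  have "((\<lambda>\<theta>. \<theta> * mass) \<longlongrightarrow> 0) (at_right 0)" by (auto intro!: tendsto_eq_intros)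
  then have G1_lim: "(G1 \<longlongrightarrow> 0) (at_right 0)"
    by (rule Lim_null_comparison[rotated]) (use i1 in \<open>auto simp: eventually_at_right_less intro!: eventually_at_rightI[of 0 1]\<close>)
  have G2: "ennreal (G2 \<theta>) = (\<integral>\<^sup>+x. ennreal (indicator {1..} x * \<kappa> \<theta> x) \<partial>\<pi>)" if "0 < \<theta>" for \<theta>
    unfolding G2_def using i2[OF that] nonneg[OF that]
    by (intro nn_integral_eq_integral[symmetric]) (auto split: split_indicator)
  have "((\<lambda>\<theta>. ennreal (G2 \<theta>)) \<longlongrightarrow> big_jumps) (at_right 0)"
  proof (rule tendsto_at_right_sequentially[where b = 1])
    fix S :: "nat \<Rightarrow> real" assume S: "\<And>n. 0 < S n" "decseq S" "S \<longlonglongrightarrow> 0"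
    have "(\<lambda>n. \<integral>\<^sup>+x. ennreal (indicator {1..} x * \<kappa> (S n) x) \<partial>\<pi>) \<longlonglongrightarrow> (\<integral>\<^sup>+x. ennreal (indicator {1..} x * x) \<partial>\<pi>)"
    proof (rule nn_integral_LIMSEQ)
      show "incseq (\<lambda>n x. ennreal (indicator {1..} x * \<kappa> (S n) x))"
        using S antimono by (auto simp: incseq_def le_fun_def decseq_def split: split_indicator intro!: ennreal_leI)
      show "(\<lambda>n. ennreal (indicator {1..} x * \<kappa> (S n) x)) \<longlonglongrightarrow> ennreal (indicator {1..} x * x)" for x
      proof (cases "1 \<le> x")
        case True
        have "(\<lambda>n. \<kappa> (S n) x) \<longlonglongrightarrow> x"
        proof (rule tendsto_sandwich)
          show "(\<lambda>n. x - S n * x\<^sup>2) \<longlonglongrightarrow> x" using S(3) by (auto intro!: tendsto_eq_intros)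
        qed (use True S lower upper in auto)
        then show ?thesis using True by (simp add: tendsto_ennrealI)
      qed simp
    qed simp
    moreover have "(\<integral>\<^sup>+x. ennreal (indicator {1..} x * x) \<partial>\<pi>) = big_jumps"
      unfolding big_jumps_def by (rule nn_integral_cong) (auto split: split_indicator)
    ultimately show "(\<lambda>n. ennreal (G2 (S n))) \<longlonglongrightarrow> big_jumps" using G2 S by simp
  qed simp
  then have "((\<lambda>\<theta>. enn2ereal (ennreal (G2 \<theta>))) \<longlongrightarrow> enn2ereal big_jumps) (at_right 0)"
    by (intro continuous_on_tendsto_compose[OF continuous_on_enn2ereal]) auto
  moreover have "eventually (\<lambda>\<theta>. enn2ereal (ennreal (G2 \<theta>)) = ereal (G2 \<theta>)) (at_right 0)"
  proof (rule eventually_at_rightI[of 0 1])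
    fix \<theta> :: real assume "\<theta> \<in> {0<..<1}"
    then have "0 \<le> G2 \<theta>" unfolding G2_def using nonneg
      by (intro Bochner_Integration.integral_nonneg) (auto split: split_indicator)
    then show "enn2ereal (ennreal (G2 \<theta>)) = ereal (G2 \<theta>)" by (simp add: enn2ereal_ennreal)
  qed simp
  ultimately have "((\<lambda>\<theta>. ereal (G2 \<theta>)) \<longlongrightarrow> enn2ereal big_jumps) (at_right 0)"
    by (rule Lim_transform_eventually)
  then have "((\<lambda>\<theta>. - ereal (G2 \<theta>)) \<longlongrightarrow> - enn2ereal big_jumps) (at_right 0)"
    by (rule tendsto_uminus_ereal)
  moreover have "((\<lambda>\<theta>. ereal (G1 \<theta>)) \<longlongrightarrow> ereal 0) (at_right 0)"
    using G1_lim by simp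
  ultimately have "((\<lambda>\<theta>. - ereal (G2 \<theta>) + ereal (G1 \<theta>)) \<longlongrightarrow> - enn2ereal big_jumps + ereal 0) (at_right 0)"
    by (intro tendsto_add_ereal_general1) auto
  moreover have "eventually (\<lambda>\<theta>. - ereal (G2 \<theta>) + ereal (G1 \<theta>) = ereal (G \<theta>)) (at_right 0)"
    by (rule eventually_at_rightI[of 0 1]) (auto simp: G)
  ultimately have "((\<lambda>\<theta>. ereal (G \<theta>)) \<longlongrightarrow> - enn2ereal big_jumps + ereal 0) (at_right 0)"
    by (rule Lim_transform_eventually)
  then show ?thesis by (simp add: zero_ereal_def[symmetric])
qed

text \<open>\<open>G\<close> may diverge, but \<theta> times \<kappa> is at most 1 and tends to 0
  pointwise. Hence \<phi>(\<theta>) tends to -q even if the large jumps have infinite first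
  moment.\<close>

lemma scaled_G_tendsto: "((\<lambda>\<theta>. \<theta> * G \<theta>) \<longlongrightarrow> 0) (at_right 0)"
proof (rule tendsto_at_right_sequentially[where b = 1])
  fix S :: "nat \<Rightarrow> real" assume S: "\<And>n. 0 < S n" "\<And>n. S n < 1" "S \<longlonglongrightarrow> 0"
  have "(\<lambda>n. \<integral>x. S n * (indicator {0<..<1} x * x - \<kappa> (S n) x) \<partial>\<pi>) \<longlonglongrightarrow> (\<integral>x. 0 \<partial>\<pi>)"
  proof (rule integral_dominated_convergence)
    \<comment> \<open>For S n < 1 the factor S n (S n + 1 / S n) coming from
      \<open>integrand_bound\<close> is at most 2.\<close>
    show "integrable \<pi> (\<lambda>x. 2 * min 1 (x\<^sup>2))" using integrable_min by simp
    show "AE x in \<pi>. (\<lambda>n. S n * (indicator {0<..<1} x * x - \<kappa> (S n) x)) \<longlonglongrightarrow> 0"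
      using AE_pos
    proof eventually_elim
      case (elim x)
      show ?case
      proof (rule Lim_null_comparison)
        show "(\<lambda>n. S n * (2 * x)) \<longlonglongrightarrow> 0" using S(3) by (auto intro!: tendsto_eq_intros)
        have "norm (S n * (indicator {0<..<1} x * x - \<kappa> (S n) x)) \<le> S n * (2 * x)" for n
          unfolding norm_mult using S(1)[of n] upper[of "S n" x] nonneg[of "S n" x] elim
          by (intro mult_mono) (auto split: split_indicator)
        then show "\<forall>\<^sub>F n in sequentially. norm (S n * (indicator {0<..<1} x * x - \<kappa> (S n) x)) \<le> S n * (2 * x)"
          by simp
      qed
    qed
    show "AE x in \<pi>. norm (S n * (indicator {0<..<1} x * x - \<kappa> (S n) x)) \<le> 2 * min 1 (x\<^sup>2)" for n
      using AE_pos
    proof eventually_elim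
      case (elim x)
      have "norm (S n * (indicator {0<..<1} x * x - \<kappa> (S n) x)) \<le> S n * ((S n + 1 / S n) * min 1 (x\<^sup>2))"
        unfolding norm_mult using S(1)[of n] integrand_bound[OF S(1) elim, of n] by (intro mult_mono) auto
      also have "\<dots> = (S n * S n + 1) * min 1 (x\<^sup>2)" using S(1)[of n] by (simp add: field_simps)
      also have "\<dots> \<le> 2 * min 1 (x\<^sup>2)"
        using S(1)[of n] S(2)[of n] mult_le_one[of "S n" "S n"] by (intro mult_right_mono) auto
      finally show ?case .
    qed
  qed auto
  then show "(\<lambda>n. S n * G (S n)) \<longlonglongrightarrow> 0" by (simp add: G_def)
qed simp

end

context levy_measure
begin

sublocale trunc1: levy_truncation \<pi> "\<lambda>\<theta> x. x * exp (- \<theta> * x)"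
proof unfold_locales
  fix \<theta> x :: real assume p: "0 < \<theta>" "0 < x"
  have "x * (1 - \<theta> * x) \<le> x * exp (- \<theta> * x)"
    using p exp_ge_add_one_self[of "- \<theta> * x"] by (intro mult_left_mono) auto
  then show "x - \<theta> * x\<^sup>2 \<le> x * exp (- \<theta> * x)" by (simp add: algebra_simps power2_eq_square)
  show "x * exp (- \<theta> * x) \<le> x" "0 \<le> x * exp (- \<theta> * x)" using p by auto
  have "\<theta> * x \<le> exp (\<theta> * x)" using exp_ge_add_one_self[of "\<theta> * x"] by linarith
  then show "x * exp (- \<theta> * x) \<le> 1 / \<theta>" using p by (simp add: exp_minus field_simps)
  fix \<theta>' assume "\<theta> \<le> \<theta>'"
  then show "x * exp (- \<theta>' * x) \<le> x * exp (- \<theta> * x)" using p by simp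
qed simp

sublocale trunc2: levy_truncation \<pi> "\<lambda>\<theta> x. (1 - exp (- \<theta> * x)) / \<theta>"
proof unfold_locales
  fix \<theta> x :: real assume p: "0 < \<theta>" "0 < x"
  show "x - \<theta> * x\<^sup>2 \<le> (1 - exp (- \<theta> * x)) / \<theta>" "(1 - exp (- \<theta> * x)) / \<theta> \<le> x"
    using one_minus_exp_div_bounds[of \<theta> x] p by auto
  show "(1 - exp (- \<theta> * x)) / \<theta> \<le> 1 / \<theta>" "0 \<le> (1 - exp (- \<theta> * x)) / \<theta>"
    using p by (auto intro!: divide_right_mono)
  fix \<theta>' assume "\<theta> \<le> \<theta>'"
  then show "(1 - exp (- \<theta>' * x)) / \<theta>' \<le> (1 - exp (- \<theta> * x)) / \<theta>"
    using one_minus_exp_div_antimono p by blast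
qed simp

lemma jump_integral_of_real:
  assumes "0 < \<theta>"
  shows "(\<integral>x. jump_integrand (complex_of_real \<theta>) x \<partial>\<pi>) = complex_of_real (\<theta> * trunc2.G \<theta>)"
    and "integrable \<pi> (jump_integrand (complex_of_real \<theta>))"
proof -
  have e: "jump_integrand (complex_of_real \<theta>) x =
      complex_of_real (\<theta> * (indicator {0<..<1} x * x - (1 - exp (- \<theta> * x)) / \<theta>))" for x
    using assms by (auto simp: jump_integrand_def field_simps exp_of_real[symmetric] split: split_indicator)
  show "(\<integral>x. jump_integrand (complex_of_real \<theta>) x \<partial>\<pi>) = complex_of_real (\<theta> * trunc2.G \<theta>)"
    unfolding e trunc2.G_def by (simp only: integral_complex_of_real integral_mult_right_zero)
  show "integrable \<pi> (jump_integrand (complex_of_real \<theta>))"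
    unfolding e using trunc2.integrable_integrand[OF assms] by (intro integrable_of_real integrable_mult_right)
qed

text \<open>The first order term in h is the integrand of \<open>trunc1\<close>. In the remainder,
  |h| < \<theta> / 2 lets exp (- \<theta> x) absorb the growth exp (|h| x) of the Taylor bound and
  still leaves exp (- \<theta> x / 2). Increments are complex because \<open>deriv\<close> is the
  complex derivative.\<close>

lemma jump_integral_has_derivative:
  assumes \<theta>: "0 < \<theta>"
  shows "((\<lambda>\<zeta>. \<integral>x. jump_integrand \<zeta> x \<partial>\<pi>) has_field_derivative complex_of_real (trunc1.G \<theta>)) (at (complex_of_real \<theta>))"
proof (rule has_field_derivative_quadratic_remainder)
  show "0 < \<theta> / 2" using \<theta> by simp
  fix h :: complex assume h: "norm h < \<theta> / 2"
  define R where "R x = exp (- complex_of_real \<theta> * x) * (exp (- h * complex_of_real x) - 1 + h * complex_of_real x)" for x :: real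
  define D where "D x = complex_of_real (indicator {0<..<1} x * x - x * exp (- \<theta> * x))" for x :: real
  have R: "norm (R x) \<le> ((norm h)\<^sup>2 * (1 + 8 / \<theta>\<^sup>2)) * min 1 (x\<^sup>2)" if x: "0 < x" for x
  proof -
    have "norm (exp (- h * complex_of_real x) - 1 + h * complex_of_real x)
        \<le> exp (norm (- h * complex_of_real x)) * (norm (- h * complex_of_real x))\<^sup>2"
    proof -
      have "exp w - (\<Sum>i\<le>1. w ^ i / fact i) = exp w - 1 - w" for w :: complex by simp
      then show ?thesis using Taylor_exp_field[of "- h * complex_of_real x" 1] by (simp add: numeral_2_eq_2 diff_diff_eq2 diff_add_eq)
    qed
    also have "\<dots> = exp (norm h * x) * ((norm h)\<^sup>2 * x\<^sup>2)"
      using x by (simp add: norm_mult power_mult_distrib)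
    also have "\<dots> \<le> exp (\<theta> / 2 * x) * ((norm h)\<^sup>2 * x\<^sup>2)"
      using h x by (intro mult_right_mono) auto
    finally have "norm (R x) \<le> exp (- \<theta> * x) * (exp (\<theta> / 2 * x) * ((norm h)\<^sup>2 * x\<^sup>2))"
      unfolding R_def norm_mult by (intro mult_mono) (auto simp: norm_exp_eq_Re)
    also have "\<dots> = (norm h)\<^sup>2 * (x\<^sup>2 * exp (- (\<theta> * x / 2)))"
    proof -
      have "exp (- \<theta> * x) * exp (\<theta> / 2 * x) = exp (- (\<theta> * x / 2))" by (simp add: exp_add[symmetric])
      then show ?thesis by (metis mult.assoc mult.commute)
    qed
    also have "\<dots> \<le> (norm h)\<^sup>2 * ((1 + 8 / \<theta>\<^sup>2) * min 1 (x\<^sup>2))"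
    proof (rule mult_left_mono)
      \<comment> \<open>Origin of 8 / \<theta>^2: u^2 / 2 \<le> exp u at u = \<theta> x / 2. It
        handles large x; the summand 1 handles x < 1.\<close>
      have "(\<theta> * x / 2)\<^sup>2 / 2 \<le> exp (\<theta> * x / 2)"
        using exp_lower_Taylor_quadratic[of "\<theta> * x / 2"] mult_pos_pos[OF \<theta> x] by linarith
      then have "x\<^sup>2 \<le> 8 / \<theta>\<^sup>2 * exp (\<theta> * x / 2)" using \<theta> by (simp add: field_simps power2_eq_square)
      then have 1: "x\<^sup>2 * exp (- (\<theta> * x / 2)) \<le> 8 / \<theta>\<^sup>2" by (simp add: exp_minus field_simps)
      have 2: "x\<^sup>2 * exp (- (\<theta> * x / 2)) \<le> x\<^sup>2 * 1" using \<theta> x by (intro mult_left_mono) auto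
      have "0 \<le> 8 * x\<^sup>2 / \<theta>\<^sup>2" by simp
      then have "x\<^sup>2 * exp (- (\<theta> * x / 2)) \<le> x\<^sup>2 + 8 * x\<^sup>2 / \<theta>\<^sup>2" using 2 by linarith
      then show "x\<^sup>2 * exp (- (\<theta> * x / 2)) \<le> (1 + 8 / \<theta>\<^sup>2) * min 1 (x\<^sup>2)"
        using 1 by (simp add: min_def distrib_right)
    qed simp
    finally show ?thesis by (simp add: mult.assoc)
  qed
  have [measurable]: "R \<in> borel_measurable borel" unfolding R_def[abs_def] by measurable
  have Ri: "integrable \<pi> R" "norm (integral\<^sup>L \<pi> R) \<le> ((norm h)\<^sup>2 * (1 + 8 / \<theta>\<^sup>2)) * mass"
    using integrable_bounded[of R "(norm h)\<^sup>2 * (1 + 8 / \<theta>\<^sup>2)"] R by auto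
  have Di: "integrable \<pi> D" "integral\<^sup>L \<pi> D = complex_of_real (trunc1.G \<theta>)"
    unfolding D_def[abs_def] trunc1.G_def using trunc1.integrable_integrand[OF \<theta>]
    by (intro integrable_of_real) (auto simp only: integral_complex_of_real)
  have "jump_integrand (complex_of_real \<theta> + h) x = jump_integrand (complex_of_real \<theta>) x + R x + h * D x" for x
  proof -
    have "exp (- (complex_of_real \<theta> + h) * complex_of_real x) = exp (- complex_of_real \<theta> * x) * exp (- h * complex_of_real x)"
      by (simp add: exp_add[symmetric] algebra_simps)
    moreover have "complex_of_real (exp (- \<theta> * x)) = exp (- complex_of_real \<theta> * x)"
      by (simp add: exp_of_real[symmetric])
    ultimately show ?thesis
      by (simp add: jump_integrand_def R_def D_def algebra_simps split: split_indicator)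
  qed
  then have "(\<integral>x. jump_integrand (complex_of_real \<theta> + h) x \<partial>\<pi>) =
      (\<integral>x. jump_integrand (complex_of_real \<theta>) x \<partial>\<pi>) + integral\<^sup>L \<pi> R + h * complex_of_real (trunc1.G \<theta>)"
    using Ri(1) Di jump_integral_of_real(2)[OF \<theta>] by simp
  then show "norm ((\<integral>x. jump_integrand (complex_of_real \<theta> + h) x \<partial>\<pi>) - (\<integral>x. jump_integrand (complex_of_real \<theta>) x \<partial>\<pi>)
      - h * complex_of_real (trunc1.G \<theta>)) \<le> ((1 + 8 / \<theta>\<^sup>2) * mass) * (norm h)\<^sup>2"
    using Ri(2) by (simp add: ac_simps)
qed

end

text \<open>\<open>Lim\<close> is a description operator, so a value of \<open>lim0\<close> is
  meaningful only after convergence in \<open>ereal\<close> has been shown.\<close>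

lemma lim0_eqI: "((\<lambda>\<theta>. ereal (g \<theta>)) \<longlongrightarrow> L) (at_right 0) \<Longrightarrow> lim0 g = L"
  unfolding lim0_def by (rule tendsto_Lim) auto

section \<open>The vector field at a fixed time and its limits at the origin\<close>

locale levy_triplet = levy_measure +
  fixes q a b :: real and f :: "complex \<Rightarrow> complex"
  assumes q_nonneg: "0 \<le> q" and b_nonneg: "0 \<le> b"
    and f_eq: "\<And>\<zeta>. \<zeta> \<in> Hplane \<Longrightarrow> f \<zeta> = - complex_of_real q + complex_of_real a * \<zeta> + complex_of_real b * \<zeta>\<^sup>2 +
        (\<integral>x. jump_integrand \<zeta> x \<partial>\<pi>)"
begin

definition H :: "real \<Rightarrow> real" where "H \<theta> = - q / \<theta> + a + b * \<theta> + trunc2.G \<theta>"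

lemma f_of_real: "0 < \<theta> \<Longrightarrow> f (complex_of_real \<theta>) = complex_of_real (\<theta> * H \<theta>)"
  by (subst f_eq) (auto simp: Hplane_def jump_integral_of_real H_def field_simps power2_eq_square)

lemma deriv_f_of_real:
  assumes "0 < \<theta>"
  shows "deriv f (complex_of_real \<theta>) = complex_of_real (a + 2 * b * \<theta> + trunc1.G \<theta>)"
proof (rule DERIV_imp_deriv)
  have "open Hplane" unfolding Hplane_def by (rule open_halfspace_Re_gt)
  moreover have "complex_of_real \<theta> \<in> Hplane" using assms by (simp add: Hplane_def)
  moreover have "((\<lambda>\<zeta>. - complex_of_real q + complex_of_real a * \<zeta> + complex_of_real b * \<zeta>\<^sup>2 +
        (\<integral>x. jump_integrand \<zeta> x \<partial>\<pi>)) has_field_derivative complex_of_real (a + 2 * b * \<theta> + trunc1.G \<theta>)) (at (complex_of_real \<theta>))"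
    by (rule derivative_eq_intros jump_integral_has_derivative assms refl | simp)+
  \<comment> \<open>\<open>f_eq\<close> holds on the half-plane only, so the derivative is
    transferred through equality in a neighbourhood.\<close>
  ultimately show "(f has_field_derivative complex_of_real (a + 2 * b * \<theta> + trunc1.G \<theta>)) (at (complex_of_real \<theta>))"
    using f_eq by (subst DERIV_cong_ev[OF refl _ refl]) (auto simp: eventually_nhds)
qed

lemma H_mono:
  assumes "0 < \<theta>" "\<theta> \<le> \<theta>'"
  shows "H \<theta> \<le> H \<theta>'"
proof -
  have "q / \<theta>' \<le> q / \<theta>" using assms q_nonneg by (intro divide_left_mono) auto
  moreover have "b * \<theta> \<le> b * \<theta>'" using assms b_nonneg by (intro mult_left_mono) auto
  ultimately show ?thesis using trunc2.G_mono[OF assms] by (simp add: H_def)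
qed

lemma H_bound: "0 < \<theta> \<Longrightarrow> \<bar>H \<theta>\<bar> \<le> q / \<theta> + \<bar>a\<bar> + b * \<theta> + (\<theta> + 1 / \<theta>) * mass"
proof -
  assume t: "0 < \<theta>"
  have "0 \<le> q / \<theta>" "0 \<le> b * \<theta>" using t q_nonneg b_nonneg by auto
  with trunc2.G_bound[OF t] show ?thesis unfolding H_def minus_divide_left[symmetric] by linarith
qed

lemma f_tendsto: "lim0 (\<lambda>\<theta>. Re (f (complex_of_real \<theta>))) = ereal (- q)"
proof (rule lim0_eqI)
  have "((\<lambda>\<theta>. - q + a * \<theta> + b * \<theta>\<^sup>2 + \<theta> * trunc2.G \<theta>) \<longlongrightarrow> - q + a * 0 + b * 0\<^sup>2 + 0) (at_right 0)"
    by (intro tendsto_intros trunc2.scaled_G_tendsto)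
  then have "((\<lambda>\<theta>. Re (f (complex_of_real \<theta>))) \<longlongrightarrow> - q) (at_right 0)"
    by (simp, elim Lim_transform_eventually, intro eventually_at_rightI[of 0 1])
       (auto simp: f_of_real H_def field_simps power2_eq_square)
  then show "((\<lambda>\<theta>. ereal (Re (f (complex_of_real \<theta>)))) \<longlongrightarrow> ereal (- q)) (at_right 0)" by simp
qed

text \<open>Differentiation removes the constant q, so this limit has the same form whether or not q
  vanishes, in contrast to the limit of \<open>H\<close>.\<close>

lemma deriv_f_tendsto: "lim0 (\<lambda>\<theta>. Re (deriv f (complex_of_real \<theta>))) = ereal a - enn2ereal big_jumps"
proof (rule lim0_eqI)
  have "((\<lambda>\<theta>. a + 2 * b * \<theta>) \<longlongrightarrow> a + 2 * b * 0) (at_right 0)" by (intro tendsto_intros)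
  then have "((\<lambda>\<theta>. ereal (a + 2 * b * \<theta>)) \<longlongrightarrow> ereal a) (at_right 0)" by simp
  from tendsto_add_ereal_general1[OF _ trunc1.G_tendsto this]
  have "((\<lambda>\<theta>. ereal (trunc1.G \<theta>) + ereal (a + 2 * b * \<theta>)) \<longlongrightarrow> - enn2ereal big_jumps + ereal a) (at_right 0)" by simp
  then show "((\<lambda>\<theta>. ereal (Re (deriv f (complex_of_real \<theta>)))) \<longlongrightarrow> ereal a - enn2ereal big_jumps) (at_right 0)"
    unfolding minus_ereal_def add.commute[of "ereal a"]
    by (elim Lim_transform_eventually, intro eventually_at_rightI[of 0 1]) (auto simp: deriv_f_of_real)
qed

lemma H_tendsto:
  assumes "q = 0"
  shows "((\<lambda>\<theta>. ereal (H \<theta>)) \<longlongrightarrow> ereal a - enn2ereal big_jumps) (at_right 0)"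
proof -
  have "((\<lambda>\<theta>. a + b * \<theta>) \<longlongrightarrow> a + b * 0) (at_right 0)" by (intro tendsto_intros)
  then have "((\<lambda>\<theta>. ereal (a + b * \<theta>)) \<longlongrightarrow> ereal a) (at_right 0)" by simp
  from tendsto_add_ereal_general1[OF _ trunc2.G_tendsto this]
  have "((\<lambda>\<theta>. ereal (trunc2.G \<theta>) + ereal (a + b * \<theta>)) \<longlongrightarrow> - enn2ereal big_jumps + ereal a) (at_right 0)" by simp
  moreover have "ereal (trunc2.G \<theta>) + ereal (a + b * \<theta>) = ereal (H \<theta>)" for \<theta>
    unfolding H_def using assms by simp
  ultimately show ?thesis
    unfolding minus_ereal_def add.commute[of "ereal a"] by (simp only:)
qed

lemma H_tendsto_minus_infinity:
  assumes "q > 0"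
  shows "((\<lambda>\<theta>. ereal (H \<theta>)) \<longlongrightarrow> -\<infinity>) (at_right 0)"
proof -
  have "filterlim (\<lambda>\<theta>. q * inverse \<theta>) at_top (at_right 0)"
    by (rule filterlim_tendsto_pos_mult_at_top[OF tendsto_const assms filterlim_inverse_at_top_right])
  then have "filterlim (\<lambda>\<theta>. - (q * inverse \<theta>)) at_bot (at_right 0)"
    by (simp add: filterlim_uminus_at_top)
  \<comment> \<open>A majorant of \<open>H\<close> for \<theta> < 1: b \<theta> \<le> b and, by
    monotonicity, \<open>G\<close> at \<theta> is at most \<open>G\<close> at 1, so only the term
    with q is unbounded.\<close>
  then have lim: "filterlim (\<lambda>\<theta>. (\<bar>a\<bar> + b + trunc2.G 1) + - (q * inverse \<theta>)) at_bot (at_right 0)"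
    by (subst filterlim_tendsto_add_at_bot_iff[OF tendsto_const])
  have "filterlim H at_bot (at_right 0)"
  proof (rule filterlim_at_bot_mono[OF lim], rule eventually_at_rightI[of 0 1])
    fix \<theta> :: real assume t: "\<theta> \<in> {0<..<1}"
    have "b * \<theta> \<le> b * 1" using t b_nonneg by (intro mult_left_mono) auto
    then show "H \<theta> \<le> (\<bar>a\<bar> + b + trunc2.G 1) + - (q * inverse \<theta>)"
      using t trunc2.G_mono[of \<theta> 1] by (simp add: H_def divide_inverse)
  qed simp
  then show ?thesis unfolding tendsto_MInfty filterlim_at_bot_dense by simp
qed

end

section \<open>Concave Laplace exponents and the mean\<close>

text \<open>Together with \<open>lim0_eqI\<close> this makes \<open>lim0\<close> of V and of V' a
  genuine limit, the supremum always existing in \<open>ereal\<close>.\<close>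

lemma tendsto_SUP_at_right:
  fixes f :: "real \<Rightarrow> ereal"
  assumes "\<And>x y. 0 < x \<Longrightarrow> x \<le> y \<Longrightarrow> f y \<le> f x"
  shows "(f \<longlongrightarrow> (SUP x\<in>{0<..}. f x)) (at_right 0)"
proof (rule order_tendstoI)
  fix c assume "c < (SUP x\<in>{0<..}. f x)"
  then obtain x where "0 < x" "c < f x" by (auto simp: less_SUP_iff)
  then show "\<forall>\<^sub>F x in at_right 0. c < f x"
    using assms by (intro eventually_at_rightI[of 0 x]) (auto intro: less_le_trans)
next
  fix c assume "(SUP x\<in>{0<..}. f x) < c"
  then show "\<forall>\<^sub>F x in at_right 0. f x < c"
    by (intro eventually_at_rightI[of 0 1]) (auto intro: le_less_trans[OF SUP_upper])
qed

locale bernstein_like =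
  fixes V V' :: "real \<Rightarrow> real"
  assumes pos: "\<And>\<theta>. 0 < \<theta> \<Longrightarrow> 0 < V \<theta>"
    and mono: "\<And>\<theta> \<theta>'. 0 < \<theta> \<Longrightarrow> \<theta> \<le> \<theta>' \<Longrightarrow> V \<theta> \<le> V \<theta>'"
    and concave: "\<And>u x y. 0 < x \<Longrightarrow> 0 < y \<Longrightarrow> 0 \<le> u \<Longrightarrow> u \<le> 1 \<Longrightarrow> u * V x + (1 - u) * V y \<le> V (u * x + (1 - u) * y)"
    and deriv: "\<And>\<theta>. 0 < \<theta> \<Longrightarrow> (V has_real_derivative V' \<theta>) (at \<theta>)"
begin

text \<open>Concavity cleared of denominators, so that linear arithmetic can use it for
  interpolation and, solved for an outer value, for extrapolation.\<close>

lemma above_chord: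
  assumes "0 < x" "x \<le> y" "y \<le> z" "x < z"
  shows "(z - y) * V x + (y - x) * V z \<le> (z - x) * V y"
proof -
  define u where "u = (z - y) / (z - x)"
  have u: "0 \<le> u" "u \<le> 1" "1 - u = (y - x) / (z - x)" using assms by (auto simp: u_def field_simps)
  have "u * x + (1 - u) * z = y"
  proof -
    have "u * x + (1 - u) * z = ((z - y) * x + (y - x) * z) / (z - x)"
      unfolding u(3) unfolding u_def by (simp add: add_divide_distrib)
    also have "(z - y) * x + (y - x) * z = (z - x) * y" by (simp add: algebra_simps)
    finally show ?thesis using assms by simp
  qed
  with concave[of x z u] u assms have "u * V x + (1 - u) * V z \<le> V y" by simp
  then have "((z - y) * V x + (y - x) * V z) / (z - x) \<le> V y"
    unfolding u(3) unfolding u_def by (simp add: add_divide_distrib)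
  then show ?thesis using assms by (simp add: pos_divide_le_eq mult.commute)
qed

lemma below_tangent:
  assumes "0 < x" "0 < c"
  shows "V x \<le> V c + V' c * (x - c)"
proof -
  have "convex_on {0<..} (\<lambda>\<theta>. - V \<theta>)"
  proof (rule convex_onI)
    fix t x y :: real assume "0 < t" "t < 1" "x \<in> {0<..}" "y \<in> {0<..}"
    then show "- V ((1 - t) *\<^sub>R x + t *\<^sub>R y) \<le> (1 - t) * - V x + t * - V y"
      using concave[of x y "1 - t"] by simp
  qed simp
  moreover have "((\<lambda>\<theta>. - V \<theta>) has_field_derivative - V' c) (at c within {0<..})"
    using deriv[OF assms(2)] by (auto intro!: derivative_eq_intros intro: DERIV_subset)
  ultimately have "- V x - - V c \<ge> - V' c * (x - c)"
    using assms by (intro convex_on_imp_above_tangent[of "{0<..}"]) (auto simp: interior_open)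
  then show ?thesis by simp
qed

lemma deriv_antimono:
  assumes "0 < x" "x \<le> y"
  shows "V' y \<le> V' x"
proof (cases "x = y")
  case False
  have "V x \<le> V y + V' y * (x - y)" "V y \<le> V x + V' x * (y - x)"
    using assms below_tangent by auto
  then have "V' y * (y - x) \<le> V' x * (y - x)" by (simp add: algebra_simps)
  then show ?thesis using False assms by simp
qed simp

lemma deriv_tendsto: "((\<lambda>\<theta>. ereal (V' \<theta>)) \<longlongrightarrow> lim0 V') (at_right 0)"
proof -
  have "((\<lambda>\<theta>. ereal (V' \<theta>)) \<longlongrightarrow> (SUP x\<in>{0<..}. ereal (V' x))) (at_right 0)"
    by (rule tendsto_SUP_at_right) (simp add: deriv_antimono)
  with lim0_eqI[OF this] show ?thesis by simp
qed

lemma deriv_le_lim0: "0 < \<theta> \<Longrightarrow> ereal (V' \<theta>) \<le> lim0 V'"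
  by (rule tendsto_lowerbound[OF deriv_tendsto])
     (auto simp: deriv_antimono intro!: eventually_at_rightI[of 0 \<theta>])

lemma tendsto: "((\<lambda>\<theta>. ereal (V \<theta>)) \<longlongrightarrow> lim0 V) (at_right 0)"
proof -
  have "((\<lambda>\<theta>. - ereal (V \<theta>)) \<longlongrightarrow> (SUP x\<in>{0<..}. - ereal (V x))) (at_right 0)"
    by (rule tendsto_SUP_at_right) (simp add: mono)
  from tendsto_uminus_ereal[OF this]
  have *: "((\<lambda>\<theta>. ereal (V \<theta>)) \<longlongrightarrow> - (SUP x\<in>{0<..}. - ereal (V x))) (at_right 0)" by simp
  with lim0_eqI[OF this] show ?thesis by simp
qed

lemma lim0_eq_0_iff: "lim0 V = 0 \<longleftrightarrow> (V \<longlongrightarrow> 0) (at_right 0)"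
  using tendsto lim0_eqI[of V "ereal 0"] by (auto simp: zero_ereal_def)

text \<open>By the mean value theorem on [0, \<theta>], V \<theta> / \<theta> is a value of V' at an
  inner point and so lies between V' \<theta> and the limit of V' at 0.\<close>

lemma ratio_tendsto:
  assumes "lim0 V = 0"
  shows "((\<lambda>\<theta>. ereal (V \<theta> / \<theta>)) \<longlongrightarrow> lim0 V') (at_right 0)"
proof -
  \<comment> \<open>V has no prescribed value at 0; the value 0 makes it continuous there, its limit
    being 0.\<close>
  define W where "W x = (if x \<le> 0 then 0 else V x)" for x
  have "V' \<theta> \<le> V \<theta> / \<theta> \<and> ereal (V \<theta> / \<theta>) \<le> lim0 V'" if t: "0 < \<theta>" for \<theta>
  proof -
    have dW: "(W has_real_derivative V' x) (at x)" if "0 < x" for x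
    proof -
      have "eventually (\<lambda>y. W y = V y) (nhds x)"
        using that unfolding eventually_nhds by (intro exI[of _ "{0<..}"]) (auto simp: W_def)
      then show ?thesis using deriv[OF that] by (subst DERIV_cong_ev[OF refl _ refl])
    qed
    have "continuous_on {0..\<theta>} W"
      unfolding continuous_on_def
    proof
      fix x assume x: "x \<in> {0..\<theta>}"
      show "(W \<longlongrightarrow> W x) (at x within {0..\<theta>})"
      proof (cases "x = 0")
        case True
        have "(V \<longlongrightarrow> 0) (at_right 0)" using assms lim0_eq_0_iff by simp
        then have "(W \<longlongrightarrow> 0) (at_right 0)"
          by (elim Lim_transform_eventually, intro eventually_at_rightI[of 0 1]) (auto simp: W_def)
        then show ?thesis using True t by (simp add: W_def at_within_Icc_at_right)
      next
        case False
        then have "isCont W x" using dW[of x] x DERIV_isCont by auto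
        then show ?thesis using continuous_at_imp_continuous_at_within continuous_within by blast
      qed
    qed
    then obtain \<xi> where \<xi>: "0 < \<xi>" "\<xi> < \<theta>" "W \<theta> - W 0 = (\<theta> - 0) * V' \<xi>"
      using MVT[of 0 \<theta> W] t dW by (metis DERIV_unique real_differentiable_def)
    then have "V \<theta> / \<theta> = V' \<xi>" using t by (simp add: W_def)
    then show ?thesis using \<xi> deriv_antimono[of \<xi> \<theta>] deriv_le_lim0 by simp
  qed
  then show ?thesis
    by (intro tendsto_sandwich[OF _ _ deriv_tendsto tendsto_const] eventually_at_rightI[of 0 1]) auto
qed

text \<open>This is the chord from the origin, where the limit of V is nonnegative. As 0 is outside
  the domain, the chord starts at \<epsilon> and loses at most \<epsilon> V 1; the two entries of
  the minimum keep \<epsilon> below w and this loss below e.\<close>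

lemma linear_lower_bound:
  assumes "0 < w" "w \<le> 1"
  shows "w * V 1 \<le> V w"
proof (cases "w = 1")
  case False
  have "w * V 1 \<le> V w + e" if e: "0 < e" for e
  proof -
    define \<epsilon> where "\<epsilon> = min (w / 2) (e / V 1)"
    have \<epsilon>: "0 < \<epsilon>" "\<epsilon> < w" "\<epsilon> * V 1 \<le> e" using assms e pos[of 1] by (auto simp: \<epsilon>_def min_def field_simps)
    have "(1 - w) * V \<epsilon> + (w - \<epsilon>) * V 1 \<le> (1 - \<epsilon>) * V w"
      using above_chord[of \<epsilon> w 1] \<epsilon> assms by auto
    moreover have "0 \<le> (1 - w) * V \<epsilon>" using assms \<epsilon> pos[of \<epsilon>] by auto
    moreover have "(1 - \<epsilon>) * V w \<le> 1 * V w" using \<epsilon> pos[of w] assms by (intro mult_right_mono) auto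
    ultimately show ?thesis using \<epsilon>(3) by (simp add: algebra_simps)
  qed
  then show ?thesis by (rule field_le_epsilon)
qed simp

end

section \<open>Laplace transforms and means of probability measures on [0, \<infinity>]\<close>

text \<open>The continuous extension of \<open>y \<mapsto> exp (- \<theta> y)\<close> to \<open>\<infinity>\<close>; \<open>enn2real \<top> = 0\<close> would give the value \<open>1\<close> there.\<close>

definition lexp :: "real \<Rightarrow> ennreal \<Rightarrow> real" where
  "lexp \<theta> y = (if y = \<top> then 0 else exp (- \<theta> * enn2real y))"

lemma lexp_measurable [measurable]: "lexp \<theta> \<in> borel_measurable borel"
  unfolding lexp_def[abs_def] by measurable

lemma lexp_bounds: "0 < \<theta> \<Longrightarrow> 0 \<le> lexp \<theta> y \<and> lexp \<theta> y \<le> 1"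
  by (auto simp: lexp_def)

text \<open>Weak continuity of the kernels is that of measures on the compact space
  [0, \<infinity>], so a test function has to be continuous at \<open>\<top>\<close> as
  well.\<close>

lemma continuous_lexp:
  assumes "0 < \<theta>"
  shows "continuous_on UNIV (lexp \<theta>)"
  unfolding continuous_on_def
proof safe
  fix y :: ennreal
  show "(lexp \<theta> \<longlongrightarrow> lexp \<theta> y) (at y within UNIV)"
  proof (cases "y = \<top>")
    case True
    show ?thesis
    proof (rule order_tendstoI)
      fix c assume "c < lexp \<theta> y"
      then have "c < 0" using True by (simp add: lexp_def)
      then show "\<forall>\<^sub>F x in at y. c < lexp \<theta> x"
        using lexp_bounds[OF assms] by (intro always_eventually) (auto intro: less_le_trans)
    next
      fix c assume "lexp \<theta> y < c"
      then have c: "0 < c" using True by (simp add: lexp_def)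
      \<comment> \<open>The maximum with 0 keeps r nonnegative, since \<open>ennreal\<close>
        truncates negative numbers.\<close>
      define r where "r = max 0 (- ln c / \<theta>)"
      have "eventually (\<lambda>x. ennreal r < x) (at y)"
        using True by (intro order_tendstoD[OF tendsto_ident_at]) simp
      then show "\<forall>\<^sub>F x in at y. lexp \<theta> x < c"
      proof eventually_elim
        case (elim x)
        show ?case
        proof (cases "x = \<top>")
          case False
          then have "r < enn2real x" using elim
            by (metis enn2real_ennreal ennreal_enn2real_if ennreal_less_iff infinity_ennreal_def max.cobounded1 r_def)
          then have "- ln c / \<theta> < enn2real x" by (simp add: r_def)
          then have "- \<theta> * enn2real x < ln c" using assms by (simp add: field_simps)
          then have "exp (- \<theta> * enn2real x) < exp (ln c)" by (simp only: exp_less_cancel_iff)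
          then show ?thesis using c False by (simp add: lexp_def)
        qed (use c in \<open>simp add: lexp_def\<close>)
      qed
    qed
  next
    case False
    have "((\<lambda>x. exp (- \<theta> * enn2real x)) \<longlongrightarrow> exp (- \<theta> * enn2real y)) (at y)"
      using False by (intro tendsto_intros tendsto_enn2real) (auto simp: top.not_eq_extremum)
    moreover have "eventually (\<lambda>x. x < \<top>) (at y)"
      using False by (intro order_tendstoD[OF tendsto_ident_at]) (simp add: top.not_eq_extremum)
    ultimately show ?thesis using False
      by (auto simp: lexp_def elim!: Lim_transform_eventually eventually_mono)
  qed
qed

locale ennreal_prob = prob_space K for K :: "ennreal measure" +
  assumes sets_K [simp, measurable_cong]: "sets K = sets borel"
begin

lemma integrable_lexp: "0 < \<theta> \<Longrightarrow> integrable K (lexp \<theta>)"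
  by (rule integrable_const_bound[where B = 1]) (auto simp: lexp_bounds)

lemma integral_lexp:
  assumes "0 < \<theta>"
    and "(\<integral>\<^sup>+ y \<in> {..<\<top>}. ennreal (exp (- \<theta> * enn2real y)) \<partial>K) = ennreal (exp c)"
  shows "(\<integral>y. lexp \<theta> y \<partial>K) = exp c"
proof -
  have "ennreal (\<integral>y. lexp \<theta> y \<partial>K) = (\<integral>\<^sup>+ y. ennreal (lexp \<theta> y) \<partial>K)"
    using lexp_bounds[OF assms(1)] by (intro nn_integral_eq_integral[symmetric] integrable_lexp assms) auto
  also have "\<dots> = (\<integral>\<^sup>+ y \<in> {..<\<top>}. ennreal (exp (- \<theta> * enn2real y)) \<partial>K)"
    by (rule nn_integral_cong) (auto simp: lexp_def top.not_eq_extremum split: split_indicator)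
  finally show ?thesis using assms(2)
    by (simp add: ennreal_inj Bochner_Integration.integral_nonneg lexp_bounds[OF assms(1)])
qed

text \<open>As \<theta> decreases to 0, (1 - \<open>lexp\<close> \<theta> y) / \<theta> increases to
  y for every y, including \<open>\<top>\<close>, where it equals 1 / \<theta>. Monotone convergence
  then covers infinite means too.\<close>

lemma mean_tendsto:
  assumes "\<And>\<theta>. 0 < \<theta> \<Longrightarrow> (\<integral>y. lexp \<theta> y \<partial>K) = exp (- x * V \<theta>)"
  shows "((\<lambda>\<theta>. ennreal ((1 - exp (- x * V \<theta>)) / \<theta>)) \<longlongrightarrow> (\<integral>\<^sup>+y. y \<partial>K)) (at_right 0)"
proof (rule tendsto_at_right_sequentially[where b = 1])
  fix S :: "nat \<Rightarrow> real" assume S: "\<And>n. 0 < S n" "decseq S" "S \<longlonglongrightarrow> 0"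
  have eq: "ennreal ((1 - exp (- x * V \<theta>)) / \<theta>) = (\<integral>\<^sup>+y. ennreal ((1 - lexp \<theta> y) / \<theta>) \<partial>K)" if t: "0 < \<theta>" for \<theta>
  proof -
    have "(\<integral>y. (1 - lexp \<theta> y) / \<theta> \<partial>K) = (1 - exp (- x * V \<theta>)) / \<theta>"
      using assms[OF t] integrable_lexp[OF t] by (simp add: prob_space)
    then show ?thesis
      using integrable_lexp[OF t] lexp_bounds[OF t] t
      by (subst nn_integral_eq_integral) auto
  qed
  have "(\<lambda>n. \<integral>\<^sup>+y. ennreal ((1 - lexp (S n) y) / S n) \<partial>K) \<longlonglongrightarrow> (\<integral>\<^sup>+y. y \<partial>K)"
  proof (rule nn_integral_LIMSEQ)
    show "incseq (\<lambda>n y. ennreal ((1 - lexp (S n) y) / S n))"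
    proof (intro incseq_SucI le_funI ennreal_leI)
      fix n y
      have "S (Suc n) \<le> S n" using S(2) by (simp add: decseq_SucD)
      then show "(1 - lexp (S n) y) / S n \<le> (1 - lexp (S (Suc n)) y) / S (Suc n)"
        using S(1)[of n] S(1)[of "Suc n"] one_minus_exp_div_antimono[of "S (Suc n)" "S n"]
        by (auto simp: lexp_def intro: divide_left_mono)
    qed
    show "(\<lambda>n. ennreal ((1 - lexp (S n) y) / S n)) \<longlonglongrightarrow> y" for y
    proof (cases "y = \<top>")
      case True
      have "filterlim (\<lambda>n. inverse (S n)) at_top sequentially"
        using S by (intro filterlim_inverse_at_top) auto
      then show ?thesis using True by (simp add: lexp_def ennreal_tendsto_top_eq_at_top divide_inverse)
    next
      case False
      have "(\<lambda>n. (1 - exp (- S n * enn2real y)) / S n) \<longlonglongrightarrow> enn2real y"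
        using S by (intro one_minus_exp_div_tendsto) auto
      then have "(\<lambda>n. ennreal ((1 - exp (- S n * enn2real y)) / S n)) \<longlonglongrightarrow> ennreal (enn2real y)"
        by (rule tendsto_ennrealI)
      moreover have "ennreal (enn2real y) = y" using False by (simp add: less_top)
      ultimately show ?thesis using False by (simp add: lexp_def)
    qed
  qed simp
  then show "(\<lambda>n. ennreal ((1 - exp (- x * V (S n))) / S n)) \<longlonglongrightarrow> (\<integral>\<^sup>+y. y \<partial>K)"
    using eq S(1) by simp
qed simp

text \<open>The quotient is split as (1 - exp (- x V)) / V times V / \<theta>. The first factor
  tends to x because V tends to 0; as x > 0, the product of the limits is determined even if V'(0) =
  \<infinity>.\<close>

lemma mean_eq_lim0_deriv:
  assumes "bernstein_like V V'" "0 < x"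
    and K: "\<And>\<theta>. 0 < \<theta> \<Longrightarrow> (\<integral>y. lexp \<theta> y \<partial>K) = exp (- x * V \<theta>)"
    and "lim0 V = 0"
  shows "enn2ereal (\<integral>\<^sup>+y. y \<partial>K) = ereal x * lim0 V'"
proof -
  interpret bernstein_like V V' by fact
  have V0: "(V \<longlongrightarrow> 0) (at_right 0)" using assms(4) lim0_eq_0_iff by simp
  have Vpos: "eventually (\<lambda>\<theta>. 0 < V \<theta>) (at_right 0)" by (rule eventually_at_rightI[of 0 1]) (auto simp: pos)
  have "((\<lambda>\<theta>. (1 - exp (- V \<theta> * x)) / V \<theta>) \<longlongrightarrow> x) (at_right 0)"
    using assms(2) V0 Vpos by (intro one_minus_exp_div_tendsto) auto
  then have "((\<lambda>\<theta>. ereal ((1 - exp (- V \<theta> * x)) / V \<theta>)) \<longlongrightarrow> ereal x) (at_right 0)" by simp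
  then have "((\<lambda>\<theta>. ereal ((1 - exp (- V \<theta> * x)) / V \<theta>) * ereal (V \<theta> / \<theta>)) \<longlongrightarrow> ereal x * lim0 V') (at_right 0)"
    using assms(2) ratio_tendsto[OF assms(4)] by (intro tendsto_mult_ereal) auto
  moreover have "eventually (\<lambda>\<theta>. ereal ((1 - exp (- V \<theta> * x)) / V \<theta>) * ereal (V \<theta> / \<theta>)
      = enn2ereal (ennreal ((1 - exp (- x * V \<theta>)) / \<theta>))) (at_right 0)"
  proof (rule eventually_at_rightI[of 0 1])
    fix \<theta> :: real assume "\<theta> \<in> {0<..<1}"
    then have "0 < \<theta>" "0 < V \<theta>" by (auto simp: pos)
    then have "0 \<le> (1 - exp (- x * V \<theta>)) / \<theta>" "V \<theta> \<noteq> 0" using assms(2) by auto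
    then show "ereal ((1 - exp (- V \<theta> * x)) / V \<theta>) * ereal (V \<theta> / \<theta>) = enn2ereal (ennreal ((1 - exp (- x * V \<theta>)) / \<theta>))"
      by (simp add: enn2ereal_ennreal mult.commute)
  qed simp
  ultimately have "((\<lambda>\<theta>. enn2ereal (ennreal ((1 - exp (- x * V \<theta>)) / \<theta>))) \<longlongrightarrow> ereal x * lim0 V') (at_right 0)"
    by (rule Lim_transform_eventually)
  moreover have "((\<lambda>\<theta>. enn2ereal (ennreal ((1 - exp (- x * V \<theta>)) / \<theta>))) \<longlongrightarrow> enn2ereal (\<integral>\<^sup>+y. y \<partial>K)) (at_right 0)"
    using mean_tendsto[OF K] by (intro tendsto_enn2erealI)
  ultimately show ?thesis by (intro tendsto_unique) auto
qed

text \<open>With V(0+) > 0 the quotient of \<open>mean_tendsto\<close> would grow like 1 / \<theta>,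
  so a finite mean forces V(0+) = 0, and then \<open>mean_eq_lim0_deriv\<close> applies.\<close>

lemma mean_finite_iff:
  assumes "bernstein_like V V'" "0 < x"
    and K: "\<And>\<theta>. 0 < \<theta> \<Longrightarrow> (\<integral>y. lexp \<theta> y \<partial>K) = exp (- x * V \<theta>)"
  shows "(\<integral>\<^sup>+y. y \<partial>K) < \<infinity> \<longleftrightarrow> lim0 V = 0 \<and> lim0 V' < \<infinity>"
proof
  interpret bernstein_like V V' by fact
  assume fin: "(\<integral>\<^sup>+y. y \<partial>K) < \<infinity>"
  have "((\<lambda>\<theta>. enn2real (ennreal ((1 - exp (- x * V \<theta>)) / \<theta>))) \<longlongrightarrow> enn2real (\<integral>\<^sup>+y. y \<partial>K)) (at_right 0)"
    using mean_tendsto[OF K] fin by (intro tendsto_enn2real) auto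
  then have "((\<lambda>\<theta>. \<theta> * enn2real (ennreal ((1 - exp (- x * V \<theta>)) / \<theta>))) \<longlongrightarrow> 0 * enn2real (\<integral>\<^sup>+y. y \<partial>K)) (at_right 0)"
    by (intro tendsto_mult tendsto_ident_at)
  moreover have "eventually (\<lambda>\<theta>. \<theta> * enn2real (ennreal ((1 - exp (- x * V \<theta>)) / \<theta>)) = 1 - exp (- x * V \<theta>)) (at_right 0)"
    by (rule eventually_at_rightI[of 0 1]) (use assms(2) pos in \<open>auto simp: less_imp_le\<close>)
  ultimately have "((\<lambda>\<theta>. 1 - exp (- x * V \<theta>)) \<longlongrightarrow> 0) (at_right 0)"
    by (simp, elim Lim_transform_eventually)
  then have "((\<lambda>\<theta>. - ln (1 - (1 - exp (- x * V \<theta>))) / x) \<longlongrightarrow> - ln (1 - 0) / x) (at_right 0)"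
    using assms(2) by (intro tendsto_intros) auto
  then have 0: "lim0 V = 0" using assms(2) lim0_eq_0_iff by simp
  have "ereal x * lim0 V' = enn2ereal (\<integral>\<^sup>+y. y \<partial>K)"
    using mean_eq_lim0_deriv[OF assms(1,2) K 0] by simp
  moreover have "enn2ereal (\<integral>\<^sup>+y. y \<partial>K) \<noteq> \<infinity>" using fin by (metis enn2ereal_eq_top_iff top.not_eq_extremum infinity_ennreal_def)
  ultimately have "lim0 V' \<noteq> \<infinity>" using assms(2) by (metis ereal_mult_eq_PInfty less_ereal.simps(1) zero_ereal_def)
  then show "lim0 V = 0 \<and> lim0 V' < \<infinity>" using 0 by simp
next
  assume *: "lim0 V = 0 \<and> lim0 V' < \<infinity>"
  then have "enn2ereal (\<integral>\<^sup>+y. y \<partial>K) = ereal x * lim0 V'" using mean_eq_lim0_deriv[OF assms(1,2) K] by simp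
  moreover have "ereal x * lim0 V' < \<infinity>" using * assms(2) by (cases "lim0 V'") auto
  ultimately show "(\<integral>\<^sup>+y. y \<partial>K) < \<infinity>" by (metis enn2ereal_eq_top_iff top.not_eq_extremum infinity_ennreal_def less_irrefl)
qed

end

text \<open>
  Concavity of \<open>V\<close> comes from the convexity of \<open>\<theta> \<mapsto> exp (- x V(\<theta>))\<close> by letting \<open>x\<close> tend to \<open>0\<close>,
  which avoids the Bernstein representation.
\<close>

lemma bernstein_like_laplace:
  fixes K :: "real \<Rightarrow> ennreal measure"
  assumes K: "\<And>x. 0 < x \<Longrightarrow> ennreal_prob (K x)"
    and L: "\<And>\<theta> x. 0 < \<theta> \<Longrightarrow> 0 < x \<Longrightarrow> (\<integral>y. lexp \<theta> y \<partial>K x) = exp (- x * V \<theta>)"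
    and pos: "\<And>\<theta>. 0 < \<theta> \<Longrightarrow> 0 < V \<theta>"
    and deriv: "\<And>\<theta>. 0 < \<theta> \<Longrightarrow> (V has_real_derivative V' \<theta>) (at \<theta>)"
  shows "bernstein_like V V'"
proof
  fix \<theta> \<theta>' :: real assume t: "0 < \<theta>" "\<theta> \<le> \<theta>'"
  interpret ennreal_prob "K 1" by (rule K) simp
  have "(\<integral>y. lexp \<theta>' y \<partial>K 1) \<le> (\<integral>y. lexp \<theta> y \<partial>K 1)"
    using t by (intro integral_mono integrable_lexp) (auto simp: lexp_def intro: mult_right_mono)
  then show "V \<theta> \<le> V \<theta>'" using L[of \<theta> 1] L[of \<theta>' 1] t by simp
next
  fix u \<theta>1 \<theta>2 :: real assume t: "0 < \<theta>1" "0 < \<theta>2" and u: "0 \<le> u" "u \<le> 1"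
  define \<theta> where "\<theta> = u * \<theta>1 + (1 - u) * \<theta>2"
  have \<theta>: "0 < \<theta>" unfolding \<theta>_def using t u
    by (cases "u = 0") (auto intro: add_pos_nonneg)
  have le: "u * ((1 - exp (- x * V \<theta>1)) / x) + (1 - u) * ((1 - exp (- x * V \<theta>2)) / x) \<le> (1 - exp (- x * V \<theta>)) / x"
    if x: "0 < x" for x
  proof -
    interpret ennreal_prob "K x" by (rule K[OF x])
    have "(\<integral>y. lexp \<theta> y \<partial>K x) \<le> (\<integral>y. u * lexp \<theta>1 y + (1 - u) * lexp \<theta>2 y \<partial>K x)"
    proof (rule integral_mono)
      fix y
      have "exp (- \<theta> * enn2real y) \<le> u * exp (- \<theta>1 * enn2real y) + (1 - u) * exp (- \<theta>2 * enn2real y)"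
      proof -
        have "exp ((1 - (1-u)) *\<^sub>R (- \<theta>1 * enn2real y) + (1-u) *\<^sub>R (- \<theta>2 * enn2real y))
            \<le> (1 - (1-u)) * exp (- \<theta>1 * enn2real y) + (1-u) * exp (- \<theta>2 * enn2real y)"
          using u by (intro convex_onD[OF exp_convex]) auto
        moreover have "(1 - (1-u)) *\<^sub>R (- \<theta>1 * enn2real y) + (1-u) *\<^sub>R (- \<theta>2 * enn2real y) = - \<theta> * enn2real y"
          by (simp add: \<theta>_def algebra_simps)
        ultimately show ?thesis by simp
      qed
      then show "lexp \<theta> y \<le> u * lexp \<theta>1 y + (1 - u) * lexp \<theta>2 y" by (auto simp: lexp_def)
    qed (use t \<theta> integrable_lexp in auto)
    also have "\<dots> = u * exp (- x * V \<theta>1) + (1 - u) * exp (- x * V \<theta>2)"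
      using t x integrable_lexp by (simp add: L)
    finally have "u * (1 - exp (- x * V \<theta>1)) + (1 - u) * (1 - exp (- x * V \<theta>2)) \<le> 1 - exp (- x * V \<theta>)"
      using L[OF \<theta> x] by (simp add: algebra_simps)
    then have "(u * (1 - exp (- x * V \<theta>1)) + (1 - u) * (1 - exp (- x * V \<theta>2))) / x \<le> (1 - exp (- x * V \<theta>)) / x"
      using x by (intro divide_right_mono) auto
    then show ?thesis by (simp add: add_divide_distrib)
  qed
  have lim: "((\<lambda>x. (1 - exp (- x * V t)) / x) \<longlongrightarrow> V t) (at_right 0)" if "0 < t" for t
    using pos[OF that] by (intro one_minus_exp_div_tendsto) (auto intro!: eventually_at_rightI[of 0 1] simp: less_imp_le)
  have "u * V \<theta>1 + (1 - u) * V \<theta>2 \<le> V \<theta>"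
  proof (rule tendsto_le[OF _ lim[OF \<theta>]])
    show "((\<lambda>x. u * ((1 - exp (- x * V \<theta>1)) / x) + (1 - u) * ((1 - exp (- x * V \<theta>2)) / x)) \<longlongrightarrow> u * V \<theta>1 + (1 - u) * V \<theta>2) (at_right 0)"
      using t by (intro tendsto_intros lim)
    show "\<forall>\<^sub>F x in at_right 0. u * ((1 - exp (- x * V \<theta>1)) / x) + (1 - u) * ((1 - exp (- x * V \<theta>2)) / x) \<le> (1 - exp (- x * V \<theta>)) / x"
      using le by (intro eventually_at_rightI[of 0 1]) auto
  qed simp
  then show "u * V \<theta>1 + (1 - u) * V \<theta>2 \<le> V (u * \<theta>1 + (1 - u) * \<theta>2)" by (simp add: \<theta>_def)
qed (use pos deriv in auto)

section \<open>The branching process and its Laplace exponents\<close>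

lemma branching_kernelsD:
  assumes "branching_kernels k"
  shows "\<forall>s t x. (s,t) \<in> Delta \<longrightarrow> prob_space (k s t x) \<and> sets (k s t x) = sets borel"
    and "\<forall>f :: ennreal \<Rightarrow> real. continuous_on UNIV f \<longrightarrow> bounded (range f) \<longrightarrow>
         continuous_on {(s,t,x). 0 \<le> s \<and> s \<le> t \<and> 0 \<le> x}
           (\<lambda>(s,t,x). \<integral> y. f y \<partial>(k s t (ennreal x)))"
  using assms unfolding branching_kernels_def by - (elim conjE, assumption)+

lemma branching_processD:
  assumes "branching_process M F P Z k"
  shows "branching_kernels k"
    and "\<forall>t\<ge>0. Z t \<in> borel_measurable M"
    and "\<forall>s t. (s,t) \<in> Delta \<longrightarrow> subalgebra M (F s t)"
    and "\<forall>s x. 0 \<le> s \<longrightarrow> prob_space (P s x) \<and> sets (P s x) = sets M"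
    and "\<forall>s x. 0 \<le> s \<longrightarrow> emeasure (P s x) {\<omega> \<in> space M. Z s \<omega> = x} = 1"
    and "\<forall>s t u x (f :: ennreal \<Rightarrow> real). 0 \<le> s \<longrightarrow> s \<le> t \<longrightarrow> t \<le> u \<longrightarrow>
        f \<in> borel_measurable borel \<longrightarrow> bounded (range f) \<longrightarrow>
        (AE \<omega> in P s x. real_cond_exp (P s x) (F s t) (\<lambda>\<omega>. f (Z u \<omega>)) \<omega>
                         = (\<integral> y. f y \<partial>(k t u (Z t \<omega>))))"
  using assms unfolding branching_process_def by - (elim conjE, assumption)+

lemma laplace_exponentsD:
  assumes "laplace_exponents k v" "(s,t) \<in> Delta" "0 < \<theta>" "0 \<le> x"
  shows "v s t (complex_of_real \<theta>) \<in> \<real>"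
    and "(\<integral>\<^sup>+ y \<in> {..<\<top>}. ennreal (exp (- \<theta> * enn2real y)) \<partial>(k s t (ennreal x)))
          = ennreal (exp (- x * Re (v s t (complex_of_real \<theta>))))"
  using assms unfolding laplace_exponents_def by metis+

lemma abs_cont_REFD:
  assumes "abs_cont_REF v"
  shows "(s,t) \<in> Delta \<Longrightarrow> v s t holomorphic_on Hplane"
    and "(s,t) \<in> Delta \<Longrightarrow> z \<in> Hplane \<Longrightarrow> v s t z \<in> Hplane"
    and "0 \<le> s \<Longrightarrow> z \<in> Hplane \<Longrightarrow> v s s z = z"
    and "0 \<le> s \<Longrightarrow> s \<le> t \<Longrightarrow> t \<le> u \<Longrightarrow> z \<in> Hplane \<Longrightarrow> v s u z = v s t (v t u z)"
    and "z \<in> Hplane \<Longrightarrow> \<exists>f :: real \<Rightarrow> real. (\<forall>r. 0 \<le> f r) \<and>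
        (\<forall>T\<ge>0. set_integrable lborel {0..T} f) \<and>
        (\<forall>s t u. 0 \<le> s \<longrightarrow> s \<le> t \<longrightarrow> t \<le> u \<longrightarrow>
            cmod (v s u z - v s t z) \<le> (LINT r:{t..u}|lborel. f r))"
proof -
  note R = assms[unfolded abs_cont_REF_def]
  show "(s,t) \<in> Delta \<Longrightarrow> v s t holomorphic_on Hplane"
    and "(s,t) \<in> Delta \<Longrightarrow> z \<in> Hplane \<Longrightarrow> v s t z \<in> Hplane"
    using R[THEN conjunct1] by blast+
  show "0 \<le> s \<Longrightarrow> z \<in> Hplane \<Longrightarrow> v s s z = z"
    using R[THEN conjunct2, THEN conjunct1] by blast
  show "0 \<le> s \<Longrightarrow> s \<le> t \<Longrightarrow> t \<le> u \<Longrightarrow> z \<in> Hplane \<Longrightarrow> v s u z = v s t (v t u z)"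
    using R[THEN conjunct2, THEN conjunct2, THEN conjunct1] by blast
  show "z \<in> Hplane \<Longrightarrow> \<exists>f :: real \<Rightarrow> real. (\<forall>r. 0 \<le> f r) \<and>
        (\<forall>T\<ge>0. set_integrable lborel {0..T} f) \<and>
        (\<forall>s t u. 0 \<le> s \<longrightarrow> s \<le> t \<longrightarrow> t \<le> u \<longrightarrow>
            cmod (v s u z - v s t z) \<le> (LINT r:{t..u}|lborel. f r))"
    using R[THEN conjunct2, THEN conjunct2, THEN conjunct2] by (rule bspec)
qed

text \<open>The Markov property is applied at the starting time, where Z equals x almost surely, and
  the conditional expectation is integrated out. It speaks of bounded functions, so the laws are
  compared on indicators first and the possibly infinite mean is read off afterwards.\<close>

lemma branching_process_law:
  assumes bp: "branching_process M F P Z k" and st: "(s,t) \<in> Delta"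
  shows "(\<integral>\<^sup>+ \<omega>. Z t \<omega> \<partial>(P s x)) = (\<integral>\<^sup>+ y. y \<partial>(k s t x))"
proof -
  have s: "0 \<le> s" "s \<le> t" "0 \<le> t" using st by (auto simp: Delta_def)
  have "(s,s) \<in> Delta" using s by (simp add: Delta_def)
  then have sub: "subalgebra M (F s s)" and sM: "sets (P s x) = sets M" and pP: "prob_space (P s x)"
    and Z: "Z s \<in> borel_measurable M" "Z t \<in> borel_measurable M"
    and Zs: "emeasure (P s x) {\<omega> \<in> space M. Z s \<omega> = x} = 1"
    and bk: "branching_kernels k"
    using branching_processD(1-5)[OF bp] s by simp_all
  have markov: "AE \<omega> in P s x. real_cond_exp (P s x) (F s s) (\<lambda>\<omega>. f (Z t \<omega>)) \<omega> = (\<integral> y. f y \<partial>(k s t (Z s \<omega>)))"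
    if "f \<in> borel_measurable borel" "bounded (range f)" for f :: "ennreal \<Rightarrow> real"
    using branching_processD(6)[OF bp, rule_format, OF s(1) order_refl s(2) that] .
  have pk: "prob_space (k s t x)" "sets (k s t x) = sets borel"
    using branching_kernelsD(1)[OF bk] st by simp_all
  interpret P: prob_space "P s x" by (rule pP)
  interpret k: prob_space "k s t x" by (rule pk)
  have sp: "space (P s x) = space M" using sM by (rule sets_eq_imp_space_eq)
  have subP: "subalgebra (P s x) (F s s)" using sub sM sp by (simp add: subalgebra_def)
  interpret finite_measure_subalgebra "P s x" "F s s"
    by unfold_locales (rule subP)
  have [measurable]: "Z s \<in> borel_measurable (P s x)" "Z t \<in> borel_measurable (P s x)"
    using Z sM by (auto cong: measurable_cong_sets)
  have ZsAE: "AE \<omega> in P s x. Z s \<omega> = x"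
  proof -
    have "P.prob {\<omega> \<in> space M. Z s \<omega> = x} = 1" using Zs by (simp add: measure_def)
    from P.AE_prob_1[OF this] show ?thesis by auto
  qed
  have "distr (P s x) borel (Z t) = k s t x"
  proof (rule measure_eqI)
    fix A assume "A \<in> sets (distr (P s x) borel (Z t))"
    then have A[measurable]: "A \<in> sets borel" by simp
    define f :: "ennreal \<Rightarrow> real" where "f = indicator A"
    have f[measurable]: "f \<in> borel_measurable borel" by (simp add: f_def)
    have fb: "bounded (range f)" unfolding bounded_iff f_def by (intro exI[of _ 1]) (auto split: split_indicator)
    have int: "integrable (P s x) (\<lambda>\<omega>. f (Z t \<omega>))"
      by (rule P.integrable_const_bound[where B = 1]) (auto simp: f_def split: split_indicator)
    have "AE \<omega> in P s x. real_cond_exp (P s x) (F s s) (\<lambda>\<omega>. f (Z t \<omega>)) \<omega> = (\<integral> y. f y \<partial>(k s t x))"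
      using markov[OF f fb] ZsAE by eventually_elim simp
    then have "(\<integral>\<omega>. real_cond_exp (P s x) (F s s) (\<lambda>\<omega>. f (Z t \<omega>)) \<omega> \<partial>P s x) = (\<integral>\<omega>. (\<integral> y. f y \<partial>(k s t x)) \<partial>P s x)"
      by (intro integral_cong_AE) (auto intro: borel_measurable_cond_exp2)
    then have "(\<integral>\<omega>. f (Z t \<omega>) \<partial>P s x) = (\<integral> y. f y \<partial>(k s t x))"
      using real_cond_exp_int(2)[OF int] by (simp add: P.prob_space)
    moreover have "(\<integral>\<omega>. f (Z t \<omega>) \<partial>P s x) = measure (distr (P s x) borel (Z t)) A"
    proof -
      have "(\<integral>y. f y \<partial>distr (P s x) borel (Z t)) = (\<integral>\<omega>. f (Z t \<omega>) \<partial>P s x)" by (rule integral_distr) auto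
      then show ?thesis by (simp add: f_def)
    qed
    moreover have "(\<integral> y. f y \<partial>(k s t x)) = measure (k s t x) A"
      using pk(2) sets_eq_imp_space_eq[OF pk(2)] by (simp add: f_def)
    ultimately show "emeasure (distr (P s x) borel (Z t)) A = emeasure (k s t x) A"
      by (simp add: P.emeasure_eq_measure k.emeasure_eq_measure P.finite_measure_distr finite_measure.emeasure_eq_measure)
  qed (simp add: pk)
  then have "(\<integral>\<^sup>+ y. y \<partial>(k s t x)) = (\<integral>\<^sup>+ y. y \<partial>(distr (P s x) borel (Z t)))" by simp
  also have "\<dots> = (\<integral>\<^sup>+ \<omega>. Z t \<omega> \<partial>(P s x))" by (subst nn_integral_distr) auto
  finally show ?thesis by simp
qed

text \<open>Passes from the completed measure, in which gauge integrability yields measurability, to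
  \<open>lborel\<close>, in which the conditions are phrased.\<close>

lemma integrable_lebesgue_on_iff_lborel:
  fixes f :: "real \<Rightarrow> real"
  assumes "(\<lambda>x. indicator {s..t} x * f x) \<in> borel_measurable borel"
  shows "integrable (lebesgue_on {s..t}) f \<longleftrightarrow> set_integrable lborel {s..t} f"
    and "integral\<^sup>L (lebesgue_on {s..t}) f = (LINT x:{s..t}|lborel. f x)"
  using assms by (simp_all add: integrable_restrict_space integral_restrict_space set_integrable_def
      set_lebesgue_integral_def integrable_completion integral_completion)

lemma AE_lebesgue_on_Icc_iff:
  "(AE x in lebesgue_on {s..t::real}. Q x) \<longleftrightarrow> (AE x in lborel. x \<in> {s..t} \<longrightarrow> Q x)"
  by (simp add: AE_restrict_space_iff AE_completion_iff)

section \<open>Laplace exponents on the positive axis as functions of the starting time\<close>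

locale branching_setting =
  fixes k :: "real \<Rightarrow> real \<Rightarrow> ennreal \<Rightarrow> ennreal measure"
    and v :: "real \<Rightarrow> real \<Rightarrow> complex \<Rightarrow> complex"
    and \<phi> :: "complex \<Rightarrow> real \<Rightarrow> complex"
    and q a b :: "real \<Rightarrow> real"
    and \<pi> :: "real \<Rightarrow> real measure"
  assumes kernels: "branching_kernels k"
    and laplace: "laplace_exponents k v"
    and REF: "abs_cont_REF v"
    and levy: "levy_family q a b \<pi>"
    and herglotz: "herglotz_levy \<phi> q a b \<pi>"
    and assoc: "assoc_herglotz v \<phi>"
begin

definition V :: "real \<Rightarrow> real \<Rightarrow> real \<Rightarrow> real" where
  "V s t \<theta> = Re (v s t (complex_of_real \<theta>))"

definition V' :: "real \<Rightarrow> real \<Rightarrow> real \<Rightarrow> real" where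
  "V' s t \<theta> = Re (deriv (v s t) (complex_of_real \<theta>))"

definition H :: "real \<Rightarrow> real \<Rightarrow> real" where
  "H r = levy_triplet.H (\<pi> r) (q r) (a r) (b r)"

definition m :: "real \<Rightarrow> ennreal" where
  "m r = (\<integral>\<^sup>+ x \<in> {1..}. ennreal x \<partial>(\<pi> r))"

lemma kernel_prob: "(s,t) \<in> Delta \<Longrightarrow> ennreal_prob (k s t x)"
  using branching_kernelsD(1)[OF kernels] unfolding ennreal_prob_def ennreal_prob_axioms_def by simp

lemma v_of_real: "(s,t) \<in> Delta \<Longrightarrow> 0 < \<theta> \<Longrightarrow> v s t (complex_of_real \<theta>) = complex_of_real (V s t \<theta>)"
  using laplace_exponentsD(1)[OF laplace, of s t \<theta> 0] by (simp add: V_def)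

lemma V_pos: "(s,t) \<in> Delta \<Longrightarrow> 0 < \<theta> \<Longrightarrow> 0 < V s t \<theta>"
  using abs_cont_REFD(2)[OF REF, of s t "complex_of_real \<theta>"] by (simp add: V_def Hplane_def)

lemma integral_kernel:
  assumes "(s,t) \<in> Delta" "0 < \<theta>" "0 \<le> x"
  shows "(\<integral>y. lexp \<theta> y \<partial>(k s t (ennreal x))) = exp (- x * V s t \<theta>)"
proof -
  interpret ennreal_prob "k s t (ennreal x)" by (rule kernel_prob) fact
  show ?thesis unfolding V_def using laplace_exponentsD(2)[OF laplace assms] by (intro integral_lexp assms)
qed

lemma V_deriv:
  assumes "(s,t) \<in> Delta" "0 < \<theta>"
  shows "(V s t has_real_derivative V' s t \<theta>) (at \<theta>)"
proof -
  have "open Hplane" unfolding Hplane_def by (rule open_halfspace_Re_gt)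
  moreover have "v s t holomorphic_on Hplane" using abs_cont_REFD(1)[OF REF] assms by blast
  ultimately have "(v s t has_field_derivative deriv (v s t) (complex_of_real \<theta>)) (at (complex_of_real \<theta>))"
    using assms by (intro holomorphic_derivI) (auto simp: Hplane_def)
  then have "((\<lambda>\<theta>. v s t (complex_of_real \<theta>)) has_vector_derivative deriv (v s t) (complex_of_real \<theta>)) (at \<theta>)"
    by (rule has_vector_derivative_real_field)
  then have "((\<lambda>\<theta>. Re (v s t (complex_of_real \<theta>))) has_real_derivative Re (deriv (v s t) (complex_of_real \<theta>))) (at \<theta>)"
    unfolding has_real_derivative_iff_has_vector_derivative by (rule bounded_linear.has_vector_derivative[OF bounded_linear_Re])
  then show ?thesis by (simp add: V_def[abs_def] V'_def)
qed

lemma bernstein: "(s,t) \<in> Delta \<Longrightarrow> bernstein_like (V s t) (V' s t)"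
  by (rule bernstein_like_laplace[where K = "\<lambda>x. k s t (ennreal x)"])
     (auto simp: kernel_prob V_pos V_deriv integral_kernel)

lemma V_id: "0 \<le> s \<Longrightarrow> 0 < \<theta> \<Longrightarrow> V s s \<theta> = \<theta>"
  using abs_cont_REFD(3)[OF REF, of s "complex_of_real \<theta>"] by (simp add: V_def Hplane_def)

lemma V_comp:
  assumes "0 \<le> s" "s \<le> t" "t \<le> u" "0 < \<theta>"
  shows "V s u \<theta> = V s t (V t u \<theta>)"
proof -
  have "v s u (complex_of_real \<theta>) = v s t (v t u (complex_of_real \<theta>))"
    using assms by (intro abs_cont_REFD(4)[OF REF]) (auto simp: Hplane_def)
  moreover have "v t u (complex_of_real \<theta>) = complex_of_real (V t u \<theta>)"
    using assms by (intro v_of_real) (auto simp: Delta_def)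
  ultimately show ?thesis by (simp only: V_def[of s u] V_def[of s t])
qed

text \<open>Continuity in the first time argument is taken from the weak continuity of the kernels,
  tested with \<open>lexp\<close> at x = 1, followed by a logarithm.\<close>

lemma continuous_V:
  assumes "0 < \<theta>"
  shows "continuous_on {0..t} (\<lambda>s. V s t \<theta>)"
proof -
  have "bounded (range (lexp \<theta>))"
    unfolding bounded_iff using lexp_bounds[OF assms] by (intro exI[of _ 1]) auto
  then have "continuous_on {(s,t,x). 0 \<le> s \<and> s \<le> t \<and> 0 \<le> x} (\<lambda>(s,t,x). \<integral> y. lexp \<theta> y \<partial>(k s t (ennreal x)))"
    using branching_kernelsD(2)[OF kernels] continuous_lexp[OF assms] by simp
  moreover have "continuous_on {0..t} (\<lambda>s. (s, t, 1::real))" by (intro continuous_intros)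
  moreover have "(\<lambda>s. (s, t, 1::real)) ` {0..t} \<subseteq> {(s,t,x). 0 \<le> s \<and> s \<le> t \<and> 0 \<le> x}" by auto
  ultimately have "continuous_on {0..t} (\<lambda>s. (\<lambda>(s,t,x). \<integral> y. lexp \<theta> y \<partial>(k s t (ennreal x))) (s, t, 1))"
    by (rule continuous_on_compose2)
  then have cont: "continuous_on {0..t} (\<lambda>s. \<integral> y. lexp \<theta> y \<partial>(k s t (ennreal 1)))" by (simp only: prod.case)
  have "(\<integral> y. lexp \<theta> y \<partial>(k s t (ennreal 1))) = exp (- V s t \<theta>)" if "s \<in> {0..t}" for s
    using integral_kernel[of s t \<theta> 1] that assms by (simp add: Delta_def)
  from continuous_on_cong[OF refl this, THEN iffD1, OF _ cont] have "continuous_on {0..t} (\<lambda>s. exp (- V s t \<theta>))"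
    by simp
  then have "continuous_on {0..t} (\<lambda>s. - ln (exp (- V s t \<theta>)))"
    by (intro continuous_on_minus continuous_on_ln) auto
  then show ?thesis by simp
qed

text \<open>Keeps the moving point in a compact part of the positive axis, where \<open>ln\<close>
  is Lipschitz and \<open>H\<close> is dominated.\<close>

lemma V_two_sided_bound:
  assumes "0 < \<theta>" "0 \<le> t"
  obtains c C where "0 < c" "c \<le> C" "\<And>s. s \<in> {0..t} \<Longrightarrow> c \<le> V s t \<theta> \<and> V s t \<theta> \<le> C"
proof -
  have ne: "{0..t} \<noteq> {}" "compact {0..t}" using assms by auto
  obtain s1 where s1: "s1 \<in> {0..t}" "\<forall>s\<in>{0..t}. V s1 t \<theta> \<le> V s t \<theta>"
    using continuous_attains_inf[OF ne(2,1) continuous_V[OF assms(1)]] by (rule bexE)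
  obtain s2 where s2: "s2 \<in> {0..t}" "\<forall>s\<in>{0..t}. V s t \<theta> \<le> V s2 t \<theta>"
    using continuous_attains_sup[OF ne(2,1) continuous_V[OF assms(1)]] by (rule bexE)
  show thesis
    using s1 s2 V_pos[of s1 t \<theta>] assms by (intro that[of "V s1 t \<theta>" "V s2 t \<theta>"]) (auto simp: Delta_def)
qed

text \<open>
  The hypothesis controls \<open>v\<close> in its second time argument and for one point at a time. An increment in the
  first argument is \<open>d(w) = V\<^sub>s\<^sub>s\<^sub>'(w) - w\<close> at the moving point \<open>w = V\<^sub>s\<^sub>'\<^sub>t(\<theta>)\<close> of some \<open>[c, C]\<close>, and concavity bounds
  \<open>d\<close> on \<open>[c, C]\<close> by its values at \<open>c/2\<close>, \<open>c\<close> and \<open>C\<close>.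
\<close>

lemma V_absolutely_continuous:
  assumes \<theta>: "0 < \<theta>" and t: "0 \<le> t"
  obtains f where "\<And>r. 0 \<le> f r" "set_integrable lborel {0..t} f"
    "\<And>s s'. 0 \<le> s \<Longrightarrow> s \<le> s' \<Longrightarrow> s' \<le> t \<Longrightarrow> \<bar>V s t \<theta> - V s' t \<theta>\<bar> \<le> (LINT r:{s..s'}|lborel. f r)"
proof -
  obtain c C where c: "0 < c" "c \<le> C" "\<And>s. s \<in> {0..t} \<Longrightarrow> c \<le> V s t \<theta> \<and> V s t \<theta> \<le> C"
    using V_two_sided_bound[OF assms] by blast
  \<comment> \<open>For a fixed point p the hypothesis is used from time s to s', starting with V s
    s, which is the identity.\<close>
  have "\<exists>f :: real \<Rightarrow> real. (\<forall>r. 0 \<le> f r) \<and> set_integrable lborel {0..t} f \<and>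
        (\<forall>s s'. 0 \<le> s \<longrightarrow> s \<le> s' \<longrightarrow> \<bar>V s s' p - p\<bar> \<le> (LINT r:{s..s'}|lborel. f r))" if p: "0 < p" for p
  proof -
    have pH: "complex_of_real p \<in> Hplane" using p by (simp add: Hplane_def)
    obtain f where f: "\<forall>r. 0 \<le> f r" "\<forall>T\<ge>0. set_integrable lborel {0..T} f"
      "\<And>s t u. 0 \<le> s \<Longrightarrow> s \<le> t \<Longrightarrow> t \<le> u \<Longrightarrow> cmod (v s u (complex_of_real p) - v s t (complex_of_real p)) \<le> (LINT r:{t..u}|lborel. f r)"
      using abs_cont_REFD(5)[OF REF pH] by blast
    have "\<bar>V s s' p - p\<bar> \<le> (LINT r:{s..s'}|lborel. f r)" if "0 \<le> s" "s \<le> s'" for s s'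
    proof -
      have "V s s' p - p = Re (v s s' (complex_of_real p) - v s s (complex_of_real p))"
        using V_id[OF that(1) p] by (simp add: V_def)
      then show ?thesis using f(3)[of s s s'] that abs_Re_le_cmod order_trans by (metis order_refl)
    qed
    then show ?thesis using f t by blast
  qed
  then obtain g where g: "\<And>p r. 0 < p \<Longrightarrow> (0::real) \<le> g p r" "\<And>p. 0 < p \<Longrightarrow> set_integrable lborel {0..t} (g p)"
    "\<And>p s s'. 0 < p \<Longrightarrow> 0 \<le> s \<Longrightarrow> s \<le> s' \<Longrightarrow> \<bar>V s s' p - p\<bar> \<le> (LINT r:{s..s'}|lborel. g p r)"
    by metis
  \<comment> \<open>2 C / c comes from extrapolating the chord over [c/2, c] up to C; the summand 1
    covers the lower bound and the case w = c.\<close>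
  define K where "K = 1 + 2 * C / c"
  have K: "1 \<le> K" using c by (simp add: K_def)
  define f where "f r = K * (g (c/2) r + g c r + g C r)" for r
  have C0: "0 < C" using c by simp
  show thesis
  proof (rule that)
    show "0 \<le> f r" for r using g(1)[of c r] g(1)[of C r] g(1)[of "c/2" r] c K by (simp add: f_def)
    show fi: "set_integrable lborel {0..t} f"
      unfolding f_def[abs_def] using g(2)[of c] g(2)[of C] g(2)[of "c/2"] c
      by (intro set_integrable_mult_right set_integral_add) auto
    fix s s' assume s: "0 \<le> s" "s \<le> s'" "s' \<le> t"
    interpret bernstein_like "V s s'" "V' s s'" using s by (intro bernstein) (simp add: Delta_def)
    define w where "w = V s' t \<theta>"
    have w: "c \<le> w" "w \<le> C" using c(3)[of s'] s by (auto simp: w_def)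
    define d where "d x = V s s' x - x" for x
    have eq: "V s t \<theta> - V s' t \<theta> = d w" using V_comp[of s s' t \<theta>] s \<theta> by (simp add: d_def w_def)
    define B where "B = \<bar>d (c/2)\<bar> + \<bar>d c\<bar> + \<bar>d C\<bar>"
    have chord: "(z - y) * d x + (y - x) * d z \<le> (z - x) * d y" if "0 < x" "x \<le> y" "y \<le> z" "x < z" for x y z
      using above_chord[OF that] by (simp add: d_def algebra_simps)
    have B0: "0 \<le> B" by (simp add: B_def)
    have KB: "B \<le> K * B" using mult_right_mono[OF K B0] by simp
    have lower: "- B \<le> d w"
    proof (cases "c < C")
      case True
      \<comment> \<open>\<open>d\<close> is concave like V, since a linear function is subtracted,
        so it lies above its chord over [c, C].\<close>
      have "(C - w) * d c + (w - c) * d C \<le> (C - c) * d w" using chord[of c w C] c w True by auto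
      moreover have "(C - w) * - B \<le> (C - w) * d c" "(w - c) * - B \<le> (w - c) * d C"
        using w by (intro mult_left_mono; simp add: B_def)+
      moreover have "(C - w) * - B + (w - c) * - B = (C - c) * - B" by (simp add: algebra_simps)
      ultimately have "(C - c) * - B \<le> (C - c) * d w" by linarith
      then show ?thesis by (rule mult_left_le_imp_le) (use True in simp)
    next
      case False
      then have "w = c" using w c by simp
      then show ?thesis by (simp add: B_def)
    qed
    have upper: "d w \<le> K * B"
    proof (cases "w = c")
      case True
      then show ?thesis using KB by (simp add: B_def)
    next
      case False
      \<comment> \<open>To the right of c, a concave function lies below the extension of its chord
        over [c/2, c].\<close>
      have "(w - c) * d (c/2) + (c - c/2) * d w \<le> (w - c/2) * d c"
        using chord[of "c/2" c w] c w False by auto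
      then have "(c/2) * d w \<le> (w - c/2) * d c - (w - c) * d (c/2)" by simp
      also have "\<dots> \<le> (w - c/2) * \<bar>d c\<bar> + (w - c) * \<bar>d (c/2)\<bar>"
      proof -
        have "(w - c/2) * d c \<le> (w - c/2) * \<bar>d c\<bar>" using w c by (intro mult_left_mono) auto
        moreover have "(w - c) * - d (c/2) \<le> (w - c) * \<bar>d (c/2)\<bar>" using w c by (intro mult_left_mono) auto
        ultimately show ?thesis by simp
      qed
      also have "\<dots> \<le> C * \<bar>d c\<bar> + C * \<bar>d (c/2)\<bar>"
        using w c by (intro add_mono mult_right_mono) auto
      also have "\<dots> \<le> C * B" using C0 by (simp add: B_def distrib_left)
      finally have "d w \<le> 2 * C / c * B" using c by (simp add: field_simps)
      also have "\<dots> \<le> K * B" using B0 by (simp add: K_def distrib_right)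
      finally show ?thesis .
    qed
    have "\<bar>d w\<bar> \<le> K * B" using lower upper KB by (simp add: abs_le_iff)
    also have "\<dots> \<le> K * ((LINT r:{s..s'}|lborel. g (c/2) r) + (LINT r:{s..s'}|lborel. g c r) + (LINT r:{s..s'}|lborel. g C r))"
      unfolding B_def d_def using g(3)[of c s s'] g(3)[of C s s'] g(3)[of "c/2" s s'] s c C0 K
      by (intro mult_left_mono add_mono) auto
    also have "\<dots> = (LINT r:{s..s'}|lborel. f r)"
    proof -
      have i: "set_integrable lborel {s..s'} (g p)" if "0 < p" for p
        using g(2)[OF that] s by (elim set_integrable_subset) auto
      show ?thesis unfolding f_def
        using i[of c] i[of C] i[of "c/2"] c C0 by (simp add: set_integral_add)
    qed
    finally show "\<bar>V s t \<theta> - V s' t \<theta>\<bar> \<le> (LINT r:{s..s'}|lborel. f r)" by (simp add: eq)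
  qed
qed

end

section \<open>The evolution equation in the starting time\<close>

lemma levy_familyD:
  assumes "levy_family q a b \<pi>"
  shows "\<forall>t\<ge>0. 0 \<le> q t \<and> 0 \<le> b t \<and> sets (\<pi> t) = sets borel \<and> emeasure (\<pi> t) {..0} = 0 \<and>
        (\<integral>\<^sup>+ x. ennreal (min 1 (x\<^sup>2)) \<partial>(\<pi> t)) < \<infinity>"
    and "\<forall>A \<in> sets borel. (\<lambda>t. emeasure (\<pi> t) A) \<in> borel_measurable borel"
    and "locL1 (\<lambda>t. ereal (q t))" "locL1 (\<lambda>t. ereal (a t))" "locL1 (\<lambda>t. ereal (b t))"
    and "locL1 (\<lambda>t. enn2ereal (\<integral>\<^sup>+ x. ennreal (min 1 (x\<^sup>2)) \<partial>(\<pi> t)))"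
  using assms unfolding levy_family_def by - (elim conjE, assumption)+

lemma locL1_set_integrable:
  assumes "locL1 (\<lambda>t. ereal (f t))" "0 \<le> s"
  shows "set_integrable lborel {s..t} f"
proof (cases "s \<le> t")
  case True
  then have "set_integrable lborel {0..t} f" using assms by (auto simp: locL1_def)
  then show ?thesis using assms(2) by (elim set_integrable_subset) auto
qed (simp add: set_integrable_def)

lemma locL1_enn2real:
  assumes "locL1 (\<lambda>t. enn2ereal (f t))"
  shows "locL1 (\<lambda>t. ereal (enn2real (f t)))"
  using assms unfolding locL1_def by simp

text \<open>The measures may have infinite mass, as Levy measures do, so measurability is built up
  from indicators by sums, multiples and monotone limits alone.\<close>

lemma measurable_nn_integral_kernel:
  fixes g :: "'b \<Rightarrow> ennreal"
  assumes sets: "\<And>t. sets (K t) = sets N"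
    and K: "\<And>A. A \<in> sets N \<Longrightarrow> (\<lambda>t. emeasure (K t) A) \<in> borel_measurable M"
    and g: "g \<in> borel_measurable N"
  shows "(\<lambda>t. \<integral>\<^sup>+ x. g x \<partial>K t) \<in> borel_measurable M"
proof -
  have meas: "f \<in> borel_measurable N \<Longrightarrow> f \<in> borel_measurable (K t)" for f :: "'b \<Rightarrow> ennreal" and t
    by (simp add: measurable_cong_sets[OF sets refl])
  show ?thesis using g
  proof (induction rule: borel_measurable_induct)
    case (cong f g)
    have "(\<integral>\<^sup>+ x. f x \<partial>K t) = (\<integral>\<^sup>+ x. g x \<partial>K t)" for t
      using cong(3) sets_eq_imp_space_eq[OF sets] by (intro nn_integral_cong) simp
    then show ?case using cong by simp
  next
    case (set A)
    then show ?case using K sets by simp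
  next
    case (mult u c)
    have "(\<integral>\<^sup>+ x. c * u x \<partial>K t) = c * (\<integral>\<^sup>+ x. u x \<partial>K t)" for t
      by (rule nn_integral_cmult[OF meas[OF mult(2)]])
    then show ?case using mult by simp
  next
    case (add u v)
    have "(\<integral>\<^sup>+ x. v x + u x \<partial>K t) = (\<integral>\<^sup>+ x. v x \<partial>K t) + (\<integral>\<^sup>+ x. u x \<partial>K t)" for t
      by (rule nn_integral_add[OF meas meas]; fact)
    then show ?case using add by simp
  next
    case (seq U)
    have "(\<integral>\<^sup>+ x. (SUP i. U i) x \<partial>K t) = (SUP i. \<integral>\<^sup>+ x. U i x \<partial>K t)" for t
      unfolding SUP_apply by (rule nn_integral_monotone_convergence_SUP[OF _ meas]; fact)
    then show ?case using seq.IH by simp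
  qed
qed

context branching_setting
begin

lemma levy_triplet_at:
  assumes "0 \<le> t"
  shows "levy_triplet (\<pi> t) (q t) (a t) (b t) (\<lambda>\<zeta>. \<phi> \<zeta> t)"
proof
  show "sets (\<pi> t) = sets borel" "emeasure (\<pi> t) {..0} = 0" "(\<integral>\<^sup>+ x. ennreal (min 1 (x\<^sup>2)) \<partial>(\<pi> t)) < \<infinity>"
    "0 \<le> q t" "0 \<le> b t"
    using levy_familyD(1)[OF levy] assms by simp_all
  fix \<zeta> assume "\<zeta> \<in> Hplane"
  then show "\<phi> \<zeta> t = - complex_of_real (q t) + complex_of_real (a t) * \<zeta> + complex_of_real (b t) * \<zeta>\<^sup>2 +
      (\<integral>x. jump_integrand \<zeta> x \<partial>\<pi> t)"
    using herglotz assms unfolding herglotz_levy_def jump_integrand_def by blast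
qed

lemma big_jumps_eq: "0 \<le> r \<Longrightarrow> levy_measure.big_jumps (\<pi> r) = m r"
proof -
  assume "0 \<le> r"
  then interpret L: levy_triplet "\<pi> r" "q r" "a r" "b r" "\<lambda>\<zeta>. \<phi> \<zeta> r" by (rule levy_triplet_at)
  show ?thesis by (simp add: L.big_jumps_def m_def)
qed

lemma phi0_eq: "0 \<le> r \<Longrightarrow> lim0 (\<lambda>\<theta>. Re (\<phi> (complex_of_real \<theta>) r)) = ereal (- q r)"
  by (rule levy_triplet.f_tendsto[OF levy_triplet_at])

lemma phid0_eq: "0 \<le> r \<Longrightarrow> lim0 (\<lambda>\<theta>. Re (deriv (\<lambda>\<zeta>. \<phi> \<zeta> r) (complex_of_real \<theta>))) = ereal (a r) - enn2ereal (m r)"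
  using levy_triplet.deriv_f_tendsto[OF levy_triplet_at, of r] big_jumps_eq by simp

lemma H_mono: "0 \<le> r \<Longrightarrow> 0 < \<theta> \<Longrightarrow> \<theta> \<le> \<theta>' \<Longrightarrow> H r \<theta> \<le> H r \<theta>'"
  unfolding H_def by (rule levy_triplet.H_mono[OF levy_triplet_at])

lemma H_tendsto:
  "0 \<le> r \<Longrightarrow> ((\<lambda>\<theta>. ereal (H r \<theta>)) \<longlongrightarrow> (if q r = 0 then ereal (a r) - enn2ereal (m r) else -\<infinity>)) (at_right 0)"
proof -
  assume r: "0 \<le> r"
  then interpret L: levy_triplet "\<pi> r" "q r" "a r" "b r" "\<lambda>\<zeta>. \<phi> \<zeta> r" by (rule levy_triplet_at)
  show ?thesis
  proof (cases "q r = 0")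
    case True
    show ?thesis unfolding if_P[OF True] H_def big_jumps_eq[OF r, symmetric] by (rule L.H_tendsto[OF True])
  next
    case False
    then have "0 < q r" using L.q_nonneg by simp
    then show ?thesis unfolding if_not_P[OF False] H_def by (rule L.H_tendsto_minus_infinity)
  qed
qed

definition W :: "real \<Rightarrow> real" where
  "W r = enn2real (\<integral>\<^sup>+ x. ennreal (min 1 (x\<^sup>2)) \<partial>(\<pi> r))"

lemma H_bound:
  assumes "0 \<le> r" "0 < \<theta>"
  shows "\<bar>H r \<theta>\<bar> \<le> q r / \<theta> + \<bar>a r\<bar> + b r * \<theta> + (\<theta> + 1 / \<theta>) * W r"
proof -
  interpret L: levy_triplet "\<pi> r" "q r" "a r" "b r" "\<lambda>\<zeta>. \<phi> \<zeta> r" by (rule levy_triplet_at) fact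
  have "L.mass = W r" unfolding L.mass_def W_def by (rule integral_eq_nn_integral) auto
  with L.H_bound[OF assms(2)] show ?thesis unfolding H_def by simp
qed

text \<open>An integrable majorant of \<open>H\<close> at a fixed point; the sum of two of them
  dominates \<open>H\<close> along a trajectory confined between two points.\<close>

lemma H_dominated:
  assumes "0 \<le> s" "0 < \<theta>"
  shows "(\<lambda>r. q r / \<theta> + \<bar>a r\<bar> + b r * \<theta> + (\<theta> + 1 / \<theta>) * W r) integrable_on {s..t}"
proof -
  have "locL1 (\<lambda>r. ereal (W r))"
    unfolding W_def by (rule locL1_enn2real[OF levy_familyD(6)[OF levy]])
  then have W: "set_integrable lborel {s..t} W" using assms by (intro locL1_set_integrable)
  have "set_integrable lborel {s..t} q" "set_integrable lborel {s..t} a" "set_integrable lborel {s..t} b"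
    using levy_familyD(3-5)[OF levy] assms by (auto intro: locL1_set_integrable)
  with W have "set_integrable lborel {s..t} (\<lambda>r. q r / \<theta> + \<bar>a r\<bar> + b r * \<theta> + (\<theta> + 1 / \<theta>) * W r)"
    by (intro set_integral_add(1) set_integrable_abs set_integrable_mult_right set_integrable_mult_left set_integrable_divide) auto
  then show ?thesis by (rule set_borel_integral_eq_integral(1))
qed

lemma log_V_derivative:
  assumes "0 \<le> t" "0 < \<theta>"
  shows "AE r in lborel. r \<in> {0..t} \<longrightarrow> ((\<lambda>r. ln (V r t \<theta>)) has_real_derivative H r (V r t \<theta>)) (at r)"
proof -
  have "complex_of_real \<theta> \<in> Hplane" using assms by (simp add: Hplane_def)
  then have "AE r in lborel. r \<in> {0..t} \<longrightarrow>
      ((\<lambda>s. v s t (complex_of_real \<theta>)) has_vector_derivative \<phi> (v r t (complex_of_real \<theta>)) r) (at r)"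
    using assoc assms unfolding assoc_herglotz_def by blast
  then show ?thesis
  proof eventually_elim
    case (elim r)
    show ?case
    proof
      assume r: "r \<in> {0..t}"
      then have D: "(r,t) \<in> Delta" by (simp add: Delta_def)
      interpret L: levy_triplet "\<pi> r" "q r" "a r" "b r" "\<lambda>\<zeta>. \<phi> \<zeta> r" by (rule levy_triplet_at) (use r in simp)
      have "((\<lambda>s. Re (v s t (complex_of_real \<theta>))) has_vector_derivative Re (\<phi> (v r t (complex_of_real \<theta>)) r)) (at r)"
        using elim r by (intro bounded_linear.has_vector_derivative[OF bounded_linear_Re]) blast
      moreover have "Re (\<phi> (v r t (complex_of_real \<theta>)) r) = V r t \<theta> * H r (V r t \<theta>)"
        unfolding v_of_real[OF D assms(2)] H_def
        by (subst L.f_of_real[OF V_pos[OF D assms(2)]]) simp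
      ultimately have "((\<lambda>s. V s t \<theta>) has_real_derivative V r t \<theta> * H r (V r t \<theta>)) (at r)"
        unfolding has_real_derivative_iff_has_vector_derivative V_def[of _ t] by simp
      then show "((\<lambda>r. ln (V r t \<theta>)) has_real_derivative H r (V r t \<theta>)) (at r)"
        using V_pos[OF D assms(2)] by (auto intro!: derivative_eq_intros)
    qed
  qed
qed

text \<open>As V stays above c, \<open>ln\<close> is Lipschitz there with constant 1 / c, and ln V
  inherits absolute continuity. The fundamental theorem yields a gauge integral only; monotonicity
  puts \<open>H\<close> at the moving point between its values at c and C, and this domination makes
  the integral absolute.\<close>

lemma log_V_integral:
  assumes s: "0 \<le> s" "s \<le> t" and \<theta>: "0 < \<theta>"
  shows "integrable (lebesgue_on {s..t}) (\<lambda>r. H r (V r t \<theta>))"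
    and "integral\<^sup>L (lebesgue_on {s..t}) (\<lambda>r. H r (V r t \<theta>)) = ln \<theta> - ln (V s t \<theta>)"
proof -
  have t: "0 \<le> t" using s by simp
  obtain c C where c: "0 < c" "c \<le> C" "\<And>s. s \<in> {0..t} \<Longrightarrow> c \<le> V s t \<theta> \<and> V s t \<theta> \<le> C"
    using V_two_sided_bound[OF \<theta> t] by metis
  obtain f where f: "\<And>r. 0 \<le> f r" "set_integrable lborel {0..t} f"
    "\<And>s s'. 0 \<le> s \<Longrightarrow> s \<le> s' \<Longrightarrow> s' \<le> t \<Longrightarrow> \<bar>V s t \<theta> - V s' t \<theta>\<bar> \<le> (LINT r:{s..s'}|lborel. f r)"
    using V_absolutely_continuous[OF \<theta> t] by metis
  have ln_le: "ln y - ln x \<le> \<bar>y - x\<bar> / c" if "c \<le> x" "c \<le> y" for x y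
  proof -
    have "ln y - ln x = ln (y / x)" using that c by (simp add: ln_div)
    also have "\<dots> \<le> y / x - 1" using that c by (intro ln_le_minus_one) auto
    also have "\<dots> = (y - x) / x" using that c by (simp add: field_simps)
    also have "\<dots> \<le> \<bar>y - x\<bar> / x" using that c by (intro divide_right_mono) auto
    also have "\<dots> \<le> \<bar>y - x\<bar> / c" using that c by (intro divide_left_mono) auto
    finally show ?thesis .
  qed
  have I: "((\<lambda>r. H r (V r t \<theta>)) has_integral ln (V t t \<theta>) - ln (V s t \<theta>)) {s..t}"
  proof (rule ftc_AE_derivative[where F = "\<lambda>r. f r / c"])
    have "set_integrable lborel {s..t} f" using f(2) s by (elim set_integrable_subset) auto
    then show "set_integrable lborel {s..t} (\<lambda>r. f r / c)" by (intro set_integrable_divide) auto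
    show "0 \<le> f r / c" for r using f(1)[of r] c by simp
    show "\<bar>ln (V y t \<theta>) - ln (V x t \<theta>)\<bar> \<le> (LINT r:{x..y}|lborel. f r / c)" if "s \<le> x" "x \<le> y" "y \<le> t" for x y
    proof -
      have "\<bar>ln (V y t \<theta>) - ln (V x t \<theta>)\<bar> \<le> \<bar>V x t \<theta> - V y t \<theta>\<bar> / c"
        using ln_le[of "V x t \<theta>" "V y t \<theta>"] ln_le[of "V y t \<theta>" "V x t \<theta>"] c(3)[of x] c(3)[of y] that s
        by (auto simp: abs_le_iff abs_minus_commute)
      also have "\<dots> \<le> (LINT r:{x..y}|lborel. f r) / c"
        using f(3)[of x y] that s c by (intro divide_right_mono) auto
      finally show ?thesis by simp
    qed
    show "AE x in lborel. x \<in> {s..t} \<longrightarrow> ((\<lambda>a. ln (V a t \<theta>)) has_real_derivative H x (V x t \<theta>)) (at x)"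
      using log_V_derivative[OF t \<theta>]
    proof (eventually_elim, intro impI)
      fix r assume d: "r \<in> {0..t} \<longrightarrow> ((\<lambda>r. ln (V r t \<theta>)) has_real_derivative H r (V r t \<theta>)) (at r)" and "r \<in> {s..t}"
      then have "r \<in> {0..t}" using s by simp
      with d show "((\<lambda>a. ln (V a t \<theta>)) has_real_derivative H r (V r t \<theta>)) (at r)" by (rule mp)
    qed
  qed (use s in auto)
  have "(\<lambda>r. H r (V r t \<theta>)) absolutely_integrable_on {s..t}"
  proof (rule measurable_bounded_by_integrable_imp_absolutely_integrable)
    show "(\<lambda>r. H r (V r t \<theta>)) \<in> borel_measurable (lebesgue_on {s..t})"
      using I by (intro integrable_imp_measurable) (rule has_integral_integrable)
    show "(\<lambda>r. (q r / c + \<bar>a r\<bar> + b r * c + (c + 1 / c) * W r) + (q r / C + \<bar>a r\<bar> + b r * C + (C + 1 / C) * W r)) integrable_on {s..t}"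
      using s c by (intro integrable_add H_dominated) auto
    fix r assume r: "r \<in> {s..t}"
    then have "H r c \<le> H r (V r t \<theta>)" "H r (V r t \<theta>) \<le> H r C"
      using c(1,2) c(3)[of r] s by (auto intro!: H_mono)
    then have "\<bar>H r (V r t \<theta>)\<bar> \<le> \<bar>H r c\<bar> + \<bar>H r C\<bar>" by linarith
    also have "\<dots> \<le> (q r / c + \<bar>a r\<bar> + b r * c + (c + 1 / c) * W r) + (q r / C + \<bar>a r\<bar> + b r * C + (C + 1 / C) * W r)"
      using r s c by (intro add_mono H_bound) auto
    finally show "norm (H r (V r t \<theta>)) \<le> (q r / c + \<bar>a r\<bar> + b r * c + (c + 1 / c) * W r) + (q r / C + \<bar>a r\<bar> + b r * C + (C + 1 / C) * W r)"
      by simp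
  qed simp
  then show i: "integrable (lebesgue_on {s..t}) (\<lambda>r. H r (V r t \<theta>))"
    by (simp add: integrable_restrict_space set_integrable_def)
  have "integral\<^sup>L (lebesgue_on {s..t}) (\<lambda>r. H r (V r t \<theta>)) = integral {s..t} (\<lambda>r. H r (V r t \<theta>))"
    using i by (intro lebesgue_integral_eq_integral) auto
  then show "integral\<^sup>L (lebesgue_on {s..t}) (\<lambda>r. H r (V r t \<theta>)) = ln \<theta> - ln (V s t \<theta>)"
    using integral_unique[OF I] V_id[OF t \<theta>] by simp
qed

lemma m_measurable:
  assumes "0 \<le> s"
  shows "(\<lambda>r. indicator {s..t} r * m r) \<in> borel_measurable borel"
proof -
  \<comment> \<open>The \<sigma>-algebra of \<pi> r is known for r \<ge> 0 only, so negative times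
    get the null measure; the cut-off to [s,t] removes them again.\<close>
  define \<pi>' where "\<pi>' r = (if 0 \<le> r then \<pi> r else null_measure borel)" for r
  have "(\<lambda>r. \<integral>\<^sup>+ x. ennreal x * indicator {1..} x \<partial>\<pi>' r) \<in> borel_measurable borel"
  proof (rule measurable_nn_integral_kernel)
    show "sets (\<pi>' r) = sets borel" for r using levy_familyD(1)[OF levy] by (simp add: \<pi>'_def)
    fix A :: "real set" assume A: "A \<in> sets borel"
    then have "(\<lambda>r. indicator {0..} r * emeasure (\<pi> r) A) \<in> borel_measurable borel"
      using levy_familyD(2)[OF levy] by (intro borel_measurable_times_ennreal) auto
    moreover have "indicator {0..} r * emeasure (\<pi> r) A = emeasure (\<pi>' r) A" for r
      using A by (simp add: \<pi>'_def)
    ultimately show "(\<lambda>r. emeasure (\<pi>' r) A) \<in> borel_measurable borel" by simp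
  qed simp
  then have "(\<lambda>r. indicator {s..t} r * (\<integral>\<^sup>+ x. ennreal x * indicator {1..} x \<partial>\<pi>' r)) \<in> borel_measurable borel"
    by simp
  moreover have "indicator {s..t} r * (\<integral>\<^sup>+ x. ennreal x * indicator {1..} x \<partial>\<pi>' r) = indicator {s..t} r * m r" for r :: real
    using assms by (auto simp: \<pi>'_def m_def split: split_indicator)
  ultimately show ?thesis by simp
qed

lemma enn2real_m_measurable:
  assumes "0 \<le> s"
  shows "(\<lambda>r. indicator {s..t} r * enn2real (m r)) \<in> borel_measurable borel"
proof -
  have "(\<lambda>r. enn2real (indicator {s..t} r * m r)) \<in> borel_measurable borel"
    using m_measurable[OF assms] by simp
  moreover have "enn2real (indicator {s..t} r * m r) = indicator {s..t} r * enn2real (m r)" for r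
    by (auto split: split_indicator)
  ultimately show ?thesis by simp
qed

lemma a_integrable: "0 \<le> s \<Longrightarrow> set_integrable lborel {s..t} a"
  using levy_familyD(4)[OF levy] by (rule locL1_set_integrable)

lemma a_measurable: "0 \<le> s \<Longrightarrow> (\<lambda>r. indicator {s..t} r * a r) \<in> borel_measurable borel"
  using borel_measurable_integrable[OF a_integrable[unfolded set_integrable_def], of s t] by simp

lemma drift_measurable: "0 \<le> s \<Longrightarrow> (\<lambda>r. indicator {s..t} r * (a r - enn2real (m r))) \<in> borel_measurable borel"
  using borel_measurable_diff[OF a_measurable enn2real_m_measurable, of s s t t] by (simp add: right_diff_distrib)

end

section \<open>First moments\<close>

context branching_setting
begin

lemma drift_le_H:
  assumes "0 \<le> r" "q r = 0" "m r \<noteq> \<top>" "0 < z"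
  shows "a r - enn2real (m r) \<le> H r z"
proof -
  have "enn2ereal (m r) = ereal (enn2real (m r))"
    using assms(3) by (metis enn2ereal_ennreal enn2real_nonneg ennreal_enn2real_if)
  moreover have "ereal (a r) - enn2ereal (m r) \<le> ereal (H r z)"
    by (rule tendsto_upperbound[OF H_tendsto[OF assms(1), unfolded if_P[OF assms(2)]]])
       (use assms H_mono in \<open>auto intro!: eventually_at_rightI[of 0 z]\<close>)
  ultimately show ?thesis by simp
qed

text \<open>By \<open>drift_le_H\<close> the integral identity gives V s t \<theta> \<le> \<theta>
  exp (- I), where I is the integral of a - m. This one bound yields both the limit 0 and the finite
  slope.\<close>

lemma first_moment_if_levy_moment:
  assumes q: "AE t in lborel. 0 \<le> t \<longrightarrow> q t = 0" and m: "locL1 (\<lambda>t. enn2ereal (m t))"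
    and st: "(s,t) \<in> Delta"
  shows "lim0 (V s t) = 0 \<and> lim0 (V' s t) < \<infinity>"
proof -
  have s: "0 \<le> s" "s \<le> t" using st by (auto simp: Delta_def)
  interpret bernstein_like "V s t" "V' s t" by (rule bernstein[OF st])
  have mfin: "AE r in lborel. 0 \<le> r \<longrightarrow> m r \<noteq> \<top>"
    using m unfolding locL1_def by (elim conjE, elim eventually_mono) (auto simp: enn2ereal_eq_top_iff)
  have "set_integrable lborel {s..t} (\<lambda>r. enn2real (m r))"
    by (rule locL1_set_integrable[OF locL1_enn2real[OF m] s(1)])
  then have "set_integrable lborel {s..t} (\<lambda>r. a r - enn2real (m r))"
    using a_integrable[OF s(1)] by (intro set_integral_diff(1))
  then have i: "integrable (lebesgue_on {s..t}) (\<lambda>r. a r - enn2real (m r))"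
    using integrable_lebesgue_on_iff_lborel(1)[OF drift_measurable[OF s(1)]] by simp
  define I where "I = integral\<^sup>L (lebesgue_on {s..t}) (\<lambda>r. a r - enn2real (m r))"
  have V_le: "V s t \<theta> \<le> \<theta> * exp (- I)" if \<theta>: "0 < \<theta>" for \<theta>
  proof -
    have "I \<le> integral\<^sup>L (lebesgue_on {s..t}) (\<lambda>r. H r (V r t \<theta>))"
      unfolding I_def
    proof (rule integral_mono_AE[OF i log_V_integral(1)[OF s \<theta>]])
      show "AE r in lebesgue_on {s..t}. a r - enn2real (m r) \<le> H r (V r t \<theta>)"
        unfolding AE_lebesgue_on_Icc_iff using q mfin
      proof eventually_elim
        case (elim r)
        show ?case
        proof
          assume "r \<in> {s..t}"
          then have "0 \<le> r" "(r,t) \<in> Delta" using s by (auto simp: Delta_def)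
          with elim show "a r - enn2real (m r) \<le> H r (V r t \<theta>)"
            by (intro drift_le_H V_pos \<theta>) auto
        qed
      qed
    qed
    then have "ln (V s t \<theta>) \<le> ln \<theta> - I" using log_V_integral(2)[OF s \<theta>] by simp
    then have "exp (ln (V s t \<theta>)) \<le> exp (ln \<theta> - I)" by simp
    then show ?thesis using \<theta> pos[OF \<theta>] by (simp add: exp_diff exp_minus divide_inverse)
  qed
  have "(V s t \<longlongrightarrow> 0) (at_right 0)"
  proof (rule tendsto_sandwich[where f = "\<lambda>_. 0" and h = "\<lambda>\<theta>. \<theta> * exp (- I)"])
    show "((\<lambda>\<theta>. \<theta> * exp (- I)) \<longlongrightarrow> 0) (at_right 0)" by (auto intro!: tendsto_eq_intros)
    show "\<forall>\<^sub>F \<theta> in at_right 0. 0 \<le> V s t \<theta>" "\<forall>\<^sub>F \<theta> in at_right 0. V s t \<theta> \<le> \<theta> * exp (- I)"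
      using V_le pos by (auto intro!: eventually_at_rightI[of 0 1] simp: less_imp_le)
  qed simp
  then have 0: "lim0 (V s t) = 0" by (simp add: lim0_eq_0_iff)
  have "lim0 (V' s t) \<le> ereal (exp (- I))"
  proof (rule tendsto_upperbound[OF ratio_tendsto[OF 0]])
    show "\<forall>\<^sub>F \<theta> in at_right 0. ereal (V s t \<theta> / \<theta>) \<le> ereal (exp (- I))"
      using V_le by (intro eventually_at_rightI[of 0 1]) (auto simp: pos_divide_le_eq mult.commute)
  qed simp
  then have "lim0 (V' s t) < \<infinity>" by (rule le_less_trans) simp
  with 0 show ?thesis by simp
qed

text \<open>Monotone convergence is used twice. The nonnegative differences h 0 - h n have bounded
  integrals, so their supremum is finite almost everywhere, which excludes q > 0 and infinite m.
  Only then is the limit of h n a real function, and the second use integrates it.\<close>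

lemma levy_moment_if_first_moment:
  assumes s: "0 \<le> s" "s \<le> t" and V0: "\<And>r. r \<in> {s..t} \<Longrightarrow> lim0 (V r t) = 0" and fin: "lim0 (V' s t) < \<infinity>"
  shows "AE r in lebesgue_on {s..t}. q r = 0 \<and> m r \<noteq> \<top>"
    and "integrable (lebesgue_on {s..t}) (\<lambda>r. a r - enn2real (m r))"
    and "lim0 (V' s t) = ereal (exp (- integral\<^sup>L (lebesgue_on {s..t}) (\<lambda>r. a r - enn2real (m r))))"
proof -
  define N where "N = lebesgue_on {s..t}"
  have D: "(r,t) \<in> Delta" "0 \<le> r" if "r \<in> {s..t}" for r using that s by (auto simp: Delta_def)
  interpret S: bernstein_like "V s t" "V' s t" by (rule bernstein) (use s in \<open>simp add: Delta_def\<close>)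
  define \<theta> where "\<theta> n = 1 / real (Suc n)" for n
  have \<theta>: "0 < \<theta> n" "\<theta> n \<le> 1" "\<theta> (Suc n) \<le> \<theta> n" for n by (auto simp: \<theta>_def field_simps)
  have \<theta>_lim: "filterlim \<theta> (at_right 0) sequentially"
  proof -
    have "(\<lambda>n. \<theta> n) \<longlonglongrightarrow> 0" unfolding \<theta>_def using LIMSEQ_inverse_real_of_nat by (simp add: inverse_eq_divide)
    then show ?thesis unfolding filterlim_at using \<theta>(1) by (auto simp: less_imp_neq[OF \<theta>(1), symmetric])
  qed
  define h where "h n r = H r (V r t (\<theta> n))" for n r
  have hi: "integrable N (h n)" "integral\<^sup>L N (h n) = - ln (V s t (\<theta> n) / \<theta> n)" for n
  proof -
    show "integrable N (h n)" unfolding N_def h_def by (rule log_V_integral[OF s \<theta>(1)])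
    show "integral\<^sup>L N (h n) = - ln (V s t (\<theta> n) / \<theta> n)"
      unfolding N_def h_def log_V_integral(2)[OF s \<theta>(1)] using \<theta>(1)[of n] S.pos[OF \<theta>(1)[of n]] by (simp add: ln_div)
  qed
  have h_dec: "h (Suc n) r \<le> h n r" if "r \<in> {s..t}" for n r
  proof -
    interpret R: bernstein_like "V r t" "V' r t" by (rule bernstein[OF D(1)[OF that]])
    show ?thesis unfolding h_def using that \<theta> D R.pos R.mono by (intro H_mono) auto
  qed
  have h_lim: "(\<lambda>n. ereal (h n r)) \<longlonglongrightarrow> (if q r = 0 then ereal (a r) - enn2ereal (m r) else -\<infinity>)" if r: "r \<in> {s..t}" for r
  proof -
    interpret R: bernstein_like "V r t" "V' r t" by (rule bernstein[OF D(1)[OF r]])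
    \<comment> \<open>Here V r t must vanish at 0 for this r and not just for r = s, because
      \<open>H\<close> is evaluated at V r t (\<theta> n).\<close>
    have "(V r t \<longlongrightarrow> 0) (at_right 0)" using V0[OF r] by (simp add: R.lim0_eq_0_iff)
    then have "filterlim (V r t) (at_right 0) (at_right 0)"
      unfolding filterlim_at by (auto intro!: eventually_at_rightI[of 0 1] simp: R.pos less_imp_neq[OF R.pos, symmetric])
    from filterlim_compose[OF H_tendsto[OF D(2)[OF r]] filterlim_compose[OF this \<theta>_lim]]
    show ?thesis by (simp add: h_def)
  qed
  have sp: "r \<in> {s..t}" if "r \<in> space N" for r using that by (simp add: N_def)
  \<comment> \<open>The slope at 0 is at least V s t 1 > 0, so that ln L is a real number.\<close>
  have "ereal 0 < lim0 (V' s t)"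
  proof -
    have "ereal (V s t 1) \<le> lim0 (V' s t)"
    proof (rule tendsto_lowerbound[OF S.ratio_tendsto[OF V0]])
      show "\<forall>\<^sub>F \<theta> in at_right 0. ereal (V s t 1) \<le> ereal (V s t \<theta> / \<theta>)"
        using S.linear_lower_bound by (intro eventually_at_rightI[of 0 1]) (auto simp: pos_le_divide_eq mult.commute)
    qed (use s in auto)
    then show ?thesis using S.pos[of 1] by (elim less_le_trans[rotated]) simp
  qed
  then obtain L where L: "lim0 (V' s t) = ereal L" "0 < L" using fin by (cases "lim0 (V' s t)") auto
  have "(\<lambda>n. ereal (V s t (\<theta> n) / \<theta> n)) \<longlonglongrightarrow> ereal L"
    using filterlim_compose[OF S.ratio_tendsto[OF V0] \<theta>_lim] s L by simp
  then have "(\<lambda>n. V s t (\<theta> n) / \<theta> n) \<longlonglongrightarrow> L" by simp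
  then have lnL: "(\<lambda>n. - ln (V s t (\<theta> n) / \<theta> n)) \<longlonglongrightarrow> - ln L" using L by (intro tendsto_intros) auto
  define E where "E n r = h 0 r - h n r" for n r
  have E0: "0 \<le> E n r" "E n r \<le> E (Suc n) r" if r: "r \<in> {s..t}" for n r
  proof -
    show "E n r \<le> E (Suc n) r" for n using h_dec[OF r, of n] by (simp add: E_def)
    then show "0 \<le> E n r" by (induction n) (auto simp: E_def intro: order_trans)
  qed
  have Ei: "integrable N (E n)" for n unfolding E_def using hi(1) by auto
  have "(\<integral>\<^sup>+r. (SUP n. ennreal (E n r)) \<partial>N) = (SUP n. \<integral>\<^sup>+r. ennreal (E n r) \<partial>N)"
  proof (rule nn_integral_monotone_convergence_SUP_AE)
    show "AE r in N. ennreal (E n r) \<le> ennreal (E (Suc n) r)" for n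
      using E0(2)[OF sp] by (auto intro!: ennreal_leI)
    show "(\<lambda>r. ennreal (E n r)) \<in> borel_measurable N" for n
      using borel_measurable_integrable[OF Ei[of n]] by simp
  qed
  also have "(\<lambda>n. \<integral>\<^sup>+r. ennreal (E n r) \<partial>N) = (\<lambda>n. ennreal (- ln (V s t (\<theta> 0) / \<theta> 0) - - ln (V s t (\<theta> n) / \<theta> n)))"
  proof
    fix n
    have "(\<integral>\<^sup>+r. ennreal (E n r) \<partial>N) = ennreal (integral\<^sup>L N (E n))"
      using Ei E0(1)[OF sp] by (intro nn_integral_eq_integral) auto
    also have "integral\<^sup>L N (E n) = integral\<^sup>L N (h 0) - integral\<^sup>L N (h n)"
      unfolding E_def using hi(1) by (intro Bochner_Integration.integral_diff)
    finally show "(\<integral>\<^sup>+r. ennreal (E n r) \<partial>N) = ennreal (- ln (V s t (\<theta> 0) / \<theta> 0) - - ln (V s t (\<theta> n) / \<theta> n))"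
      by (simp only: hi(2))
  qed
  finally have SUP_eq: "(\<integral>\<^sup>+r. (SUP n. ennreal (E n r)) \<partial>N) = (SUP n. ennreal (- ln (V s t (\<theta> 0) / \<theta> 0) - - ln (V s t (\<theta> n) / \<theta> n)))" .
  obtain B where B: "\<And>n. \<bar>- ln (V s t (\<theta> n) / \<theta> n)\<bar> \<le> B"
    using convergent_imp_Bseq[OF convergentI[OF lnL]] unfolding Bseq_def by auto
  have "(SUP n. ennreal (- ln (V s t (\<theta> 0) / \<theta> 0) - - ln (V s t (\<theta> n) / \<theta> n))) \<le> ennreal (2 * B)"
  proof (intro SUP_least ennreal_leI)
    fix n show "- ln (V s t (\<theta> 0) / \<theta> 0) - - ln (V s t (\<theta> n) / \<theta> n) \<le> 2 * B"
      using B[of 0] B[of n] by linarith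
  qed
  then have "(\<integral>\<^sup>+r. (SUP n. ennreal (E n r)) \<partial>N) \<noteq> \<infinity>"
    unfolding SUP_eq by (metis ennreal_less_top infinity_ennreal_def leD)
  then have "AE r in N. (SUP n. ennreal (E n r)) \<noteq> \<infinity>"
    using borel_measurable_integrable[OF Ei] by (intro nn_integral_PInf_AE) auto
  moreover have "AE r in N. r \<in> {s..t}" using sp by auto
  ultimately have ae: "AE r in N. q r = 0 \<and> m r \<noteq> \<top>"
  proof eventually_elim
    case (elim r)
    obtain x where x: "(SUP n. ennreal (E n r)) = ennreal x" "0 \<le> x" using elim(1) by (cases "SUP n. ennreal (E n r)") auto
    have "h 0 r - x \<le> h n r" for n
    proof -
      have "ennreal (E n r) \<le> ennreal x" unfolding x(1)[symmetric] by (rule SUP_upper) simp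
      then have "E n r \<le> x" using x(2) by (simp add: ennreal_le_iff)
      then show ?thesis by (simp add: E_def)
    qed
    then have lb: "ereal (h 0 r - x) \<le> (if q r = 0 then ereal (a r) - enn2ereal (m r) else -\<infinity>)"
      by (intro LIMSEQ_le_const[OF h_lim[OF elim(2)]]) auto
    show ?case
    proof
      show "q r = 0" using lb by (cases "q r = 0") auto
      then show "m r \<noteq> \<top>" using lb by (auto simp: minus_ereal_def top_ennreal.rep_eq top_ereal_def)
    qed
  qed
  then show "AE r in lebesgue_on {s..t}. q r = 0 \<and> m r \<noteq> \<top>" unfolding N_def .
  \<comment> \<open>The sign is changed to obtain an increasing sequence.\<close>
  define u where "u r = - (a r - enn2real (m r))" for r
  have "has_bochner_integral N u (ln L)"
  proof (rule has_bochner_integral_monotone_convergence)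
    show "integrable N (\<lambda>r. - h n r)" for n using hi(1) by simp
    show "AE r in N. mono (\<lambda>n. - h n r)"
      using h_dec[OF sp] by (auto simp: mono_iff_le_Suc)
    show "AE r in N. (\<lambda>n. - h n r) \<longlonglongrightarrow> u r"
      using ae \<open>AE r in N. r \<in> {s..t}\<close>
    proof eventually_elim
      case (elim r)
      have "enn2ereal (m r) = ereal (enn2real (m r))"
        using elim(1) by (metis enn2ereal_ennreal enn2real_nonneg ennreal_enn2real_if)
      then have "(\<lambda>n. ereal (h n r)) \<longlonglongrightarrow> ereal (a r - enn2real (m r))"
        using h_lim[OF elim(2)] elim(1) by simp
      then have "(\<lambda>n. h n r) \<longlonglongrightarrow> a r - enn2real (m r)" by simp
      then show ?case unfolding u_def by (rule tendsto_minus)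
    qed
    show "(\<lambda>n. integral\<^sup>L N (\<lambda>r. - h n r)) \<longlonglongrightarrow> ln L"
      using tendsto_minus[OF lnL] by (simp add: hi(2))
    have "(\<lambda>r. indicator {s..t} r * (a r - enn2real (m r))) \<in> borel_measurable lebesgue"
      using drift_measurable[OF s(1)] by (intro measurable_completion) simp
    then have "(\<lambda>r. a r - enn2real (m r)) \<in> borel_measurable N"
      unfolding N_def by (subst borel_measurable_restrict_space_iff) auto
    then show "u \<in> borel_measurable N" unfolding u_def by (rule borel_measurable_uminus)
  qed
  then have "integrable N u" "integral\<^sup>L N u = ln L" by (auto simp: has_bochner_integral_iff)
  then have "integrable N (\<lambda>r. - u r)" "integral\<^sup>L N (\<lambda>r. - u r) = - ln L" by auto
  then have *: "integrable N (\<lambda>r. a r - enn2real (m r))" "integral\<^sup>L N (\<lambda>r. a r - enn2real (m r)) = - ln L"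
    by (simp_all add: u_def)
  then show "integrable (lebesgue_on {s..t}) (\<lambda>r. a r - enn2real (m r))" by (simp add: N_def)
  show "lim0 (V' s t) = ereal (exp (- integral\<^sup>L (lebesgue_on {s..t}) (\<lambda>r. a r - enn2real (m r))))"
    using *(2) L by (simp add: N_def)
qed

text \<open>Once V s t \<theta> \<le> 1, \<open>linear_lower_bound\<close> for V 0 s bounds V s t
  \<theta> by V 0 t \<theta> / V 0 s 1, so the limit 0 and the finite slope both pass from V 0 t to
  V s t.\<close>

lemma first_moment_all_if_zero:
  assumes C3: "\<And>t. 0 \<le> t \<Longrightarrow> lim0 (V 0 t) = 0 \<and> lim0 (V' 0 t) < \<infinity>" and st: "(s,t) \<in> Delta"
  shows "lim0 (V s t) = 0 \<and> lim0 (V' s t) < \<infinity>"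
proof -
  have s: "0 \<le> s" "s \<le> t" "(0,s) \<in> Delta" "(0,t) \<in> Delta" using st by (auto simp: Delta_def)
  interpret A: bernstein_like "V 0 s" "V' 0 s" by (rule bernstein[OF s(3)])
  interpret B: bernstein_like "V s t" "V' s t" by (rule bernstein[OF st])
  interpret C: bernstein_like "V 0 t" "V' 0 t" by (rule bernstein[OF s(4)])
  have comp: "V 0 t \<theta> = V 0 s (V s t \<theta>)" if "0 < \<theta>" for \<theta>
    using V_comp[of 0 s t \<theta>] s that by simp
  have C0: "lim0 (V 0 t) = 0" "(V 0 t \<longlongrightarrow> 0) (at_right 0)" "lim0 (V' 0 t) < \<infinity>"
    using C3[of t] s by (auto simp: C.lim0_eq_0_iff)
  \<comment> \<open>Monotonicity of V 0 s turns this into V s t \<theta> < 1 for small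
    \<theta>.\<close>
  have "\<forall>\<^sub>F \<theta> in at_right 0. V 0 t \<theta> < V 0 s 1"
    using C0(2) A.pos[of 1] by (intro order_tendstoD) auto
  moreover have "\<forall>\<^sub>F \<theta> in at_right 0. (0::real) < \<theta>" by (simp add: eventually_at_right_less)
  ultimately have ev: "\<forall>\<^sub>F \<theta> in at_right 0. V s t \<theta> * V 0 s 1 \<le> V 0 t \<theta>"
  proof eventually_elim
    case (elim \<theta>)
    have "V s t \<theta> \<le> 1"
      using elim A.mono[of 1 "V s t \<theta>"] comp[of \<theta>] by (cases "1 \<le> V s t \<theta>") auto
    then show ?case using A.linear_lower_bound[of "V s t \<theta>"] B.pos elim comp by simp
  qed
  have "(V s t \<longlongrightarrow> 0) (at_right 0)"
  proof (rule tendsto_sandwich[where f = "\<lambda>_. 0" and h = "\<lambda>\<theta>. V 0 t \<theta> / V 0 s 1"])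
    show "((\<lambda>\<theta>. V 0 t \<theta> / V 0 s 1) \<longlongrightarrow> 0) (at_right 0)"
      using C0(2) by (auto intro!: tendsto_eq_intros simp: less_imp_neq[OF A.pos, symmetric])
    show "\<forall>\<^sub>F \<theta> in at_right 0. V s t \<theta> \<le> V 0 t \<theta> / V 0 s 1"
      using ev by eventually_elim (use A.pos[of 1] in \<open>simp add: pos_le_divide_eq\<close>)
    show "\<forall>\<^sub>F \<theta> in at_right 0. 0 \<le> V s t \<theta>"
      by (auto intro!: eventually_at_rightI[of 0 1] simp: less_imp_le B.pos)
  qed simp
  then have B0: "lim0 (V s t) = 0" by (simp add: B.lim0_eq_0_iff)
  have "ereal (V 0 s 1) * lim0 (V' s t) \<le> lim0 (V' 0 t)"
  proof (rule tendsto_le[OF _ C.ratio_tendsto[OF C0(1)]])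
    show "((\<lambda>\<theta>. ereal (V 0 s 1) * ereal (V s t \<theta> / \<theta>)) \<longlongrightarrow> ereal (V 0 s 1) * lim0 (V' s t)) (at_right 0)"
      using A.pos[of 1] by (intro tendsto_mult_ereal tendsto_const B.ratio_tendsto[OF B0]) auto
    show "\<forall>\<^sub>F \<theta> in at_right 0. ereal (V 0 s 1) * ereal (V s t \<theta> / \<theta>) \<le> ereal (V 0 t \<theta> / \<theta>)"
      using ev eventually_at_right_less[of 0]
      by eventually_elim (auto simp: mult.commute intro: divide_right_mono)
  qed simp
  then have "lim0 (V' s t) < \<infinity>" using C0(3) A.pos[of 1] by (cases "lim0 (V' s t)") auto
  with B0 show ?thesis by simp
qed

end

section \<open>Local integrability of \<phi>'(0, .) in terms of the Levy measures\<close>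

lemma real_of_ereal_minus_enn2ereal:
  "real_of_ereal (ereal x - enn2ereal y) = (if y = \<top> then 0 else x - enn2real y)"
proof (cases y)
  case (real r)
  then show ?thesis by (simp add: enn2ereal_ennreal)
next
  case top
  then show ?thesis by (simp add: top_ennreal.rep_eq top_ereal_def minus_ereal_def)
qed

lemma abs_enn2ereal_eq_infinity_iff: "\<bar>enn2ereal y\<bar> = \<infinity> \<longleftrightarrow> y = \<top>"
  by (cases y) (auto simp: enn2ereal_ennreal top_ennreal.rep_eq top_ereal_def)

lemma abs_ereal_minus_enn2ereal_eq_infinity_iff: "\<bar>ereal x - enn2ereal y\<bar> = \<infinity> \<longleftrightarrow> y = \<top>"
  by (cases y) (auto simp: enn2ereal_ennreal top_ennreal.rep_eq top_ereal_def minus_ereal_def)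

context branching_setting
begin

text \<open>\<open>g\<close> stands for \<phi>'(0, .). Where m is infinite,
  \<open>real_of_ereal\<close> returns 0 whereas a - \<open>enn2real\<close> m returns a, so the
  integrands are compared almost everywhere, by means of \<open>fin\<close>.\<close>

lemma drift_AE_eq:
  assumes s: "0 \<le> s" and g: "\<And>r. 0 \<le> r \<Longrightarrow> g r = ereal (a r) - enn2ereal (m r)"
    and fin: "AE r in lborel. r \<in> {s..t} \<longrightarrow> m r \<noteq> \<top>"
  shows "set_integrable lborel {s..t} (\<lambda>r. real_of_ereal (g r)) \<longleftrightarrow> set_integrable lborel {s..t} (\<lambda>r. a r - enn2real (m r))"
    and "(LINT r:{s..t}|lborel. real_of_ereal (g r)) = (LINT r:{s..t}|lborel. a r - enn2real (m r))"
proof -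
  note [measurable] = m_measurable[OF s, of t] enn2real_m_measurable[OF s, of t] a_measurable[OF s, of t]
  have g_eq: "indicator {s..t} r *\<^sub>R real_of_ereal (g r) =
      (if indicator {s..t} r * m r = \<top> then 0 else indicator {s..t} r * a r - indicator {s..t} r * enn2real (m r))" for r
    using s g[of r] by (auto simp: real_of_ereal_minus_enn2ereal split: split_indicator)
  have 1: "(\<lambda>r. indicator {s..t} r *\<^sub>R real_of_ereal (g r)) \<in> borel_measurable lborel"
    unfolding g_eq by measurable
  have 2: "(\<lambda>r. indicator {s..t} r *\<^sub>R (a r - enn2real (m r))) \<in> borel_measurable lborel"
    using drift_measurable[OF s, of t] by simp
  have 3: "AE r in lborel. indicator {s..t} r *\<^sub>R real_of_ereal (g r) = indicator {s..t} r *\<^sub>R (a r - enn2real (m r))"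
    using fin by eventually_elim (use s in \<open>auto simp: g real_of_ereal_minus_enn2ereal split: split_indicator\<close>)
  show "set_integrable lborel {s..t} (\<lambda>r. real_of_ereal (g r)) \<longleftrightarrow> set_integrable lborel {s..t} (\<lambda>r. a r - enn2real (m r))"
    unfolding set_integrable_def by (rule integrable_cong_AE[OF 1 2 3])
  show "(LINT r:{s..t}|lborel. real_of_ereal (g r)) = (LINT r:{s..t}|lborel. a r - enn2real (m r))"
    unfolding set_lebesgue_integral_def by (rule integral_cong_AE[OF 1 2 3])
qed

lemma set_integrable_drift_iff:
  assumes "0 \<le> s"
  shows "set_integrable lborel {s..t} (\<lambda>r. a r - enn2real (m r)) \<longleftrightarrow> set_integrable lborel {s..t} (\<lambda>r. enn2real (m r))"
proof
  assume "set_integrable lborel {s..t} (\<lambda>r. a r - enn2real (m r))"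
  from set_integral_diff(1)[OF a_integrable[OF assms] this]
  show "set_integrable lborel {s..t} (\<lambda>r. enn2real (m r))" by simp
next
  assume "set_integrable lborel {s..t} (\<lambda>r. enn2real (m r))"
  from set_integral_diff(1)[OF a_integrable[OF assms] this]
  show "set_integrable lborel {s..t} (\<lambda>r. a r - enn2real (m r))" .
qed

text \<open>As a is locally integrable, a - m and m are so together; this links the second halves of
  (5) and (6).\<close>

lemma locL1_drift_iff:
  assumes g: "\<And>r. 0 \<le> r \<Longrightarrow> g r = ereal (a r) - enn2ereal (m r)"
  shows "locL1 g \<longleftrightarrow> locL1 (\<lambda>r. enn2ereal (m r))"
proof -
  have ae: "(AE r in lborel. 0 \<le> r \<longrightarrow> \<bar>g r\<bar> \<noteq> \<infinity>) \<longleftrightarrow> (AE r in lborel. 0 \<le> r \<longrightarrow> m r \<noteq> \<top>)"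
    "(AE r in lborel. 0 \<le> r \<longrightarrow> \<bar>enn2ereal (m r)\<bar> \<noteq> \<infinity>) \<longleftrightarrow> (AE r in lborel. 0 \<le> r \<longrightarrow> m r \<noteq> \<top>)"
    by (intro AE_cong; simp add: g abs_enn2ereal_eq_infinity_iff abs_ereal_minus_enn2ereal_eq_infinity_iff)+
  have "set_integrable lborel {0..T} (\<lambda>r. real_of_ereal (g r)) \<longleftrightarrow> set_integrable lborel {0..T} (\<lambda>r. enn2real (m r))"
    if fin: "AE r in lborel. 0 \<le> r \<longrightarrow> m r \<noteq> \<top>" for T
  proof -
    have "AE r in lborel. r \<in> {0..T} \<longrightarrow> m r \<noteq> \<top>" using fin by eventually_elim auto
    from drift_AE_eq(1)[OF order_refl g this] set_integrable_drift_iff[of 0 T] show ?thesis by simp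
  qed
  then show ?thesis unfolding locL1_def ae by auto
qed

lemma levy_moment_if_first_moments:
  assumes C4: "\<And>s t. (s,t) \<in> Delta \<Longrightarrow> lim0 (V s t) = 0 \<and> lim0 (V' s t) < \<infinity>"
  shows "AE t in lborel. 0 \<le> t \<longrightarrow> q t = 0" and "locL1 (\<lambda>t. enn2ereal (m t))"
proof -
  have D: "(r,t) \<in> Delta" if "0 \<le> s" "r \<in> {s..t}" for r s t :: real using that by (auto simp: Delta_def)
  have moment: "AE r in lebesgue_on {0..T}. q r = 0 \<and> m r \<noteq> \<top>"
    "integrable (lebesgue_on {0..T}) (\<lambda>r. a r - enn2real (m r))" if "0 \<le> T" for T
    by (intro levy_moment_if_first_moment; use that C4[OF D[OF order_refl]] in force)+
  \<comment> \<open>The exceptional null set on [0, T] depends on T; the countably many integers T =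
    n suffice.\<close>
  have "AE r in lborel. \<forall>n::nat. r \<in> {0..real n} \<longrightarrow> q r = 0 \<and> m r \<noteq> \<top>"
    using moment(1)[of "real _"] unfolding AE_lebesgue_on_Icc_iff AE_all_countable by simp
  then have ae: "AE r in lborel. 0 \<le> r \<longrightarrow> q r = 0 \<and> m r \<noteq> \<top>"
    by eventually_elim (meson atLeastAtMost_iff real_arch_simple)
  then show "AE t in lborel. 0 \<le> t \<longrightarrow> q t = 0" by eventually_elim auto
  have "set_integrable lborel {0..T} (\<lambda>r. enn2real (m r))" if "0 \<le> T" for T
    using moment(2)[OF that] integrable_lebesgue_on_iff_lborel(1)[OF drift_measurable] set_integrable_drift_iff[of 0 T] by simp
  moreover have "AE r in lborel. 0 \<le> r \<longrightarrow> \<bar>enn2ereal (m r)\<bar> \<noteq> \<infinity>"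
    using ae by eventually_elim (auto simp: abs_enn2ereal_eq_infinity_iff)
  ultimately show "locL1 (\<lambda>t. enn2ereal (m t))" unfolding locL1_def by simp
qed

lemma lim0_deriv_eq_exp:
  assumes C4: "\<And>s t. (s,t) \<in> Delta \<Longrightarrow> lim0 (V s t) = 0 \<and> lim0 (V' s t) < \<infinity>"
    and g: "\<And>r. 0 \<le> r \<Longrightarrow> g r = ereal (a r) - enn2ereal (m r)"
    and st: "(s,t) \<in> Delta"
  shows "lim0 (V' s t) = ereal (exp (- (LBINT r=s..t. real_of_ereal (g r))))"
proof -
  have s: "0 \<le> s" "s \<le> t" using st by (auto simp: Delta_def)
  have V0: "lim0 (V r t) = 0" if "r \<in> {s..t}" for r using C4[of r t] that s by (auto simp: Delta_def)
  have fin: "lim0 (V' s t) < \<infinity>" using C4[OF st] by simp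
  have L: "AE r in lebesgue_on {s..t}. q r = 0 \<and> m r \<noteq> \<top>"
    "lim0 (V' s t) = ereal (exp (- integral\<^sup>L (lebesgue_on {s..t}) (\<lambda>r. a r - enn2real (m r))))"
    by (rule levy_moment_if_first_moment(1,3)[OF s V0 fin], assumption)+
  have "AE r in lborel. r \<in> {s..t} \<longrightarrow> m r \<noteq> \<top>"
    using L(1) unfolding AE_lebesgue_on_Icc_iff by eventually_elim auto
  then have "(LINT r:{s..t}|lborel. real_of_ereal (g r)) = (LINT r:{s..t}|lborel. a r - enn2real (m r))"
    using s by (intro drift_AE_eq(2) g)
  then have "(LBINT r=s..t. real_of_ereal (g r)) = integral\<^sup>L (lebesgue_on {s..t}) (\<lambda>r. a r - enn2real (m r))"
    unfolding interval_integral_Icc[OF s(2)] integrable_lebesgue_on_iff_lborel(2)[OF drift_measurable[OF s(1)]] .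
  then show ?thesis using L(2) by simp
qed

end

theorem mainTheorem4:
  fixes M :: "'w measure"
    and F :: "real \<Rightarrow> real \<Rightarrow> 'w measure"
    and P :: "real \<Rightarrow> ennreal \<Rightarrow> 'w measure"
    and Z :: "real \<Rightarrow> 'w \<Rightarrow> ennreal"
    and k :: "real \<Rightarrow> real \<Rightarrow> ennreal \<Rightarrow> ennreal measure"
    and v :: "real \<Rightarrow> real \<Rightarrow> complex \<Rightarrow> complex"
    and \<phi> :: "complex \<Rightarrow> real \<Rightarrow> complex"
    and q a b :: "real \<Rightarrow> real"
    and \<pi> :: "real \<Rightarrow> real measure"
  assumes "branching_process M F P Z k"
    and "laplace_exponents k v"
    and "abs_cont_REF v"
    and "levy_family q a b \<pi>"
    and "herglotz_levy \<phi> q a b \<pi>"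
    and "assoc_herglotz v \<phi>"
  defines "v0 \<equiv> \<lambda>s t. lim0 (\<lambda>\<theta>. Re (v s t (complex_of_real \<theta>)))"
    and "vd0 \<equiv> \<lambda>s t. lim0 (\<lambda>\<theta>. Re (deriv (v s t) (complex_of_real \<theta>)))"
    and "phi0 \<equiv> \<lambda>t. lim0 (\<lambda>\<theta>. Re (\<phi> (complex_of_real \<theta>) t))"
    and "phid0 \<equiv> \<lambda>t. lim0 (\<lambda>\<theta>. Re (deriv (\<lambda>\<zeta>. \<phi> \<zeta> t) (complex_of_real \<theta>)))"
  defines "C1 \<equiv> \<forall>x s t. 0 < x \<longrightarrow> (s,t) \<in> Delta \<longrightarrow>
                   (\<integral>\<^sup>+ \<omega>. Z t \<omega> \<partial>(P s (ennreal x))) < \<infinity>"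
    and "C2 \<equiv> \<forall>t\<ge>0. (\<integral>\<^sup>+ \<omega>. Z t \<omega> \<partial>(P 0 1)) < \<infinity>"
    and "C3 \<equiv> \<forall>t\<ge>0. v0 0 t = 0 \<and> vd0 0 t < \<infinity>"
    and "C4 \<equiv> \<forall>s t. (s,t) \<in> Delta \<longrightarrow> v0 s t = 0 \<and> vd0 s t < \<infinity>"
    and "C5 \<equiv> (AE t in lborel. 0 \<le> t \<longrightarrow> phi0 t = 0) \<and> locL1 phid0"
    and "C6 \<equiv> (AE t in lborel. 0 \<le> t \<longrightarrow> q t = 0) \<and>
              locL1 (\<lambda>t. enn2ereal (\<integral>\<^sup>+ x \<in> {1..}. ennreal x \<partial>(\<pi> t)))"
  shows "(C1 \<longleftrightarrow> C2) \<and> (C1 \<longleftrightarrow> C3) \<and> (C1 \<longleftrightarrow> C4) \<and> (C1 \<longleftrightarrow> C5) \<and> (C1 \<longleftrightarrow> C6) \<and>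
         (C1 \<longrightarrow> (\<forall>x s t. 0 < x \<longrightarrow> (s,t) \<in> Delta \<longrightarrow>
             enn2ereal (\<integral>\<^sup>+ \<omega>. Z t \<omega> \<partial>(P s (ennreal x))) = ereal x * vd0 s t \<and>
             ereal x * vd0 s t = ereal (x * exp (- (LBINT r=s..t. real_of_ereal (phid0 r))))))"
proof -
  interpret B: branching_setting k v \<phi> q a b \<pi>
    using branching_processD(1)[OF assms(1)] assms(2-6) by unfold_locales
  have v0: "v0 s t = lim0 (B.V s t)" and vd0: "vd0 s t = lim0 (B.V' s t)" for s t
    unfolding v0_def vd0_def B.V_def B.V'_def by (rule refl)+
  have phi0: "phi0 r = ereal (- q r)" and phid0: "phid0 r = ereal (a r) - enn2ereal (B.m r)" if "0 \<le> r" for r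
    using B.phi0_eq[OF that] B.phid0_eq[OF that] unfolding phi0_def phid0_def by simp_all
  have law: "(\<integral>\<^sup>+ \<omega>. Z t \<omega> \<partial>(P s (ennreal x))) = (\<integral>\<^sup>+ y. y \<partial>(k s t (ennreal x)))" if "(s,t) \<in> Delta" for s t x
    by (rule branching_process_law[OF assms(1) that])
  have mean_iff: "(\<integral>\<^sup>+ \<omega>. Z t \<omega> \<partial>(P s (ennreal x))) < \<infinity> \<longleftrightarrow> v0 s t = 0 \<and> vd0 s t < \<infinity>"
    if "0 < x" "(s,t) \<in> Delta" for x s t
    unfolding law[OF that(2)] v0 vd0
    by (rule ennreal_prob.mean_finite_iff[OF B.kernel_prob[OF that(2)] B.bernstein[OF that(2)] that(1)])
       (use that B.integral_kernel in auto)
  have mean_eq: "enn2ereal (\<integral>\<^sup>+ \<omega>. Z t \<omega> \<partial>(P s (ennreal x))) = ereal x * vd0 s t"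
    if "0 < x" "(s,t) \<in> Delta" "v0 s t = 0" for x s t
    unfolding law[OF that(2)] vd0
    by (rule ennreal_prob.mean_eq_lim0_deriv[OF B.kernel_prob[OF that(2)] B.bernstein[OF that(2)] that(1)])
       (use that B.integral_kernel v0 in auto)
  \<comment> \<open>The criterion for a finite mean does not involve x, so x = 1 recovers
    \<open>C4\<close> from \<open>C1\<close>.\<close>
  have C14: "C1 \<longleftrightarrow> C4"
    unfolding C1_def C4_def using mean_iff zero_less_one by blast
  have C23: "C2 \<longleftrightarrow> C3"
  proof -
    have "(\<integral>\<^sup>+ \<omega>. Z t \<omega> \<partial>(P 0 1)) < \<infinity> \<longleftrightarrow> v0 0 t = 0 \<and> vd0 0 t < \<infinity>" if "0 \<le> t" for t
      using mean_iff[of 1 0 t] that by (simp add: Delta_def)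
    then show ?thesis unfolding C2_def C3_def by blast
  qed
  have C43: "C4 \<Longrightarrow> C3" unfolding C3_def C4_def by (simp add: Delta_def)
  have C34: "C3 \<Longrightarrow> C4"
    unfolding C3_def C4_def v0 vd0 using B.first_moment_all_if_zero by blast
  have C6_eq: "C6 \<longleftrightarrow> (AE t in lborel. 0 \<le> t \<longrightarrow> q t = 0) \<and> locL1 (\<lambda>t. enn2ereal (B.m t))"
    unfolding C6_def B.m_def by (rule refl)
  have C64: "C6 \<Longrightarrow> C4"
    unfolding C6_eq C4_def v0 vd0 using B.first_moment_if_levy_moment by blast
  have C46: "C4 \<Longrightarrow> C6"
    unfolding C6_eq C4_def v0 vd0 using B.levy_moment_if_first_moments by blast
  have C56: "C5 \<longleftrightarrow> C6"
  proof -
    have "(AE t in lborel. 0 \<le> t \<longrightarrow> phi0 t = 0) \<longleftrightarrow> (AE t in lborel. 0 \<le> t \<longrightarrow> q t = 0)"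
      by (rule AE_cong) (auto simp: phi0 zero_ereal_def)
    then show ?thesis unfolding C5_def C6_eq using B.locL1_drift_iff[of phid0, OF phid0] by simp
  qed
  have "enn2ereal (\<integral>\<^sup>+ \<omega>. Z t \<omega> \<partial>(P s (ennreal x))) = ereal x * vd0 s t \<and>
      ereal x * vd0 s t = ereal (x * exp (- (LBINT r=s..t. real_of_ereal (phid0 r))))"
    if C4 "0 < x" "(s,t) \<in> Delta" for x s t
  proof
    have c: "lim0 (B.V s t) = 0 \<and> lim0 (B.V' s t) < \<infinity>" if "(s,t) \<in> Delta" for s t
      using \<open>C4\<close> that unfolding C4_def v0 vd0 by blast
    show "enn2ereal (\<integral>\<^sup>+ \<omega>. Z t \<omega> \<partial>(P s (ennreal x))) = ereal x * vd0 s t"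
      using c[OF that(3)] that by (intro mean_eq) (auto simp: v0)
    have "lim0 (B.V' s t) = ereal (exp (- (LBINT r=s..t. real_of_ereal (phid0 r))))"
      by (rule B.lim0_deriv_eq_exp[OF c phid0 that(3)])
    then show "ereal x * vd0 s t = ereal (x * exp (- (LBINT r=s..t. real_of_ereal (phid0 r))))"
      unfolding vd0 by simp
  qed
  then show ?thesis using C14 C23 C43 C34 C64 C46 C56 by blast
qed

end
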